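(* Let $f$ be a Hecke-holomorphic or Hecke-Maass cusp form for $\mathrm{SL}(2,\mathbb{Z})$ with normalized Fourier coefficients $\mathcal{A}_f(n)$. Let $k\geqslant 2$ be an integer, let $\delta_1\geqslant 1/2$, and let $\ell\in\mathbb{N}$ be the least natural number such that $2^{\ell+1}>\max\{k(1-\delta_1),\,k\log k\}$. Then for every $\varepsilon>0$ and all $X\geqslant 1$, $$\sum_{X\leqslant n\leqslant 2X}\ \sum_{X^{1/k}\leqslant m\leqslant(2X)^{1/k}}\mathcal{A}_f(n+m^k)\ \ll_{f,\varepsilon}\ X^{1+\frac1k-\left(\frac{1}{4k}+\frac{1}{2^{\ell+4}}\right)+\varepsilon},$$ where the implied constant depends on $f$, $\varepsilon$ and the fixed parameters $k,\delta_1$ but not on $X$.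
   Context: Fourier coefficients: write $e(x)=e^{2\pi i x}$. If $f$ is a primitive holomorphic Hecke eigen-cusp form of integral weight $\kappa$ for $\mathrm{SL}(2,\mathbb{Z})$, the $\mathcal{A}_f(n)$ are defined by $f(z)=\sum_{n\geqslant 1}\mathcal{A}_f(n)n^{(\kappa-1)/2}e(nz)$ with $\mathcal{A}_f(1)=1$. If $f$ is a primitive Hecke-Maass cusp form for $\mathrm{SL}(2,\mathbb{Z})$ with Laplace eigenvalue $\tfrac14+\nu^2$, they are defined by $f(x+iy)=2\sqrt{y}\sum_{n\neq 0}\mathcal{A}_f(n)K_{i\nu}(2\pi|n|y)e(nx)$ with $\mathcal{A}_f(1)=1$, where $K_{i\nu}$ is the $K$-Bessel function. $\mathbb{N}=\{1,2,\dots\}$; sums run over integers $n,m$. *)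

theory Defs
  imports "HOL-Complex_Analysis.Complex_Analysis"
begin

definition upper_half_plane :: "complex set" where
  "upper_half_plane = {z. Im z > 0}"

definition e_fun :: "complex \<Rightarrow> complex" where
  "e_fun z = exp (2 * of_real pi * \<i> * z)"

text \<open>
  A function on the upper half plane is a function on the whole complex plane whose values
  elsewhere are irrelevant. Weight \<open>\<kappa> = 0\<close> is invariance under SL(2,Z).
\<close>

definition modular_of_weight :: "int \<Rightarrow> (complex \<Rightarrow> complex) \<Rightarrow> bool" where
  "modular_of_weight \<kappa> f \<longleftrightarrow>
     (\<forall>(a::int) (b::int) (c::int) (d::int). a * d - b * c = 1 \<longrightarrow>
       (\<forall>z\<in>upper_half_plane.
          f ((of_int a * z + of_int b) / (of_int c * z + of_int d)) =
            (of_int c * z + of_int d) powi \<kappa> * f z))"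


subsection \<open>Holomorphic Hecke cusp forms\<close>

text \<open>
  The limit is taken as the imaginary part tends to infinity, uniformly in the real part.
\<close>

definition holomorphic_cusp_form :: "int \<Rightarrow> (complex \<Rightarrow> complex) \<Rightarrow> bool" where
  "holomorphic_cusp_form \<kappa> f \<longleftrightarrow>
     f holomorphic_on upper_half_plane \<and> modular_of_weight \<kappa> f \<and>
     (f \<longlongrightarrow> 0) (filtercomap Im at_top)"

text \<open>
  The sums in both Hecke operators run over the representatives \<open>(a, b; 0, d)\<close>, \<open>a d = n\<close>,
  \<open>0 \<le> b < d\<close>, of the integral matrices of determinant \<open>n\<close> modulo SL(2,Z).
\<close>

definition holomorphic_hecke_operator ::
    "int \<Rightarrow> nat \<Rightarrow> (complex \<Rightarrow> complex) \<Rightarrow> complex \<Rightarrow> complex" where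
  "holomorphic_hecke_operator \<kappa> n f z =
     of_nat n powi (\<kappa> - 1) *
     (\<Sum>d | d dvd n. \<Sum>b<d. of_nat d powi (- \<kappa>) * f ((of_nat (n div d) * z + of_nat b) / of_nat d))"

definition holomorphic_hecke_cusp_form :: "int \<Rightarrow> (complex \<Rightarrow> complex) \<Rightarrow> bool" where
  "holomorphic_hecke_cusp_form \<kappa> f \<longleftrightarrow>
     holomorphic_cusp_form \<kappa> f \<and>
     (\<forall>n\<ge>1. \<exists>c. \<forall>z\<in>upper_half_plane. holomorphic_hecke_operator \<kappa> n f z = c * f z)"

text \<open>Only the values of \<open>A\<close> at positive integers are constrained here.\<close>

definition holomorphic_fourier_coeffs ::
    "int \<Rightarrow> (complex \<Rightarrow> complex) \<Rightarrow> (int \<Rightarrow> complex) \<Rightarrow> bool" where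
  "holomorphic_fourier_coeffs \<kappa> f A \<longleftrightarrow>
     (\<forall>z\<in>upper_half_plane.
        ((\<lambda>n. A n * of_real (real_of_int n powr ((real_of_int \<kappa> - 1) / 2)) * e_fun (of_int n * z))
           has_sum f z) {1..})"


subsection \<open>Hecke-Maass cusp forms\<close>

definition partial_x :: "(complex \<Rightarrow> complex) \<Rightarrow> complex \<Rightarrow> complex" where
  "partial_x f z = vector_derivative (\<lambda>t. f (z + of_real t)) (at 0)"

definition partial_y :: "(complex \<Rightarrow> complex) \<Rightarrow> complex \<Rightarrow> complex" where
  "partial_y f z = vector_derivative (\<lambda>t. f (z + \<i> * of_real t)) (at 0)"

text \<open>
  Smoothness is in the sense of two real variables; here \<open>differentiable\<close> refers to the real
  Frechet derivative.
\<close>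

fun Ck_on_uhp :: "nat \<Rightarrow> (complex \<Rightarrow> complex) \<Rightarrow> bool" where
  "Ck_on_uhp 0 f \<longleftrightarrow> continuous_on upper_half_plane f"
| "Ck_on_uhp (Suc r) f \<longleftrightarrow>
     (\<forall>z\<in>upper_half_plane. f differentiable (at z)) \<and>
     Ck_on_uhp r (partial_x f) \<and> Ck_on_uhp r (partial_y f)"

definition smooth_on_uhp :: "(complex \<Rightarrow> complex) \<Rightarrow> bool" where
  "smooth_on_uhp f \<longleftrightarrow> (\<forall>r. Ck_on_uhp r f)"

definition hyperbolic_laplacian :: "(complex \<Rightarrow> complex) \<Rightarrow> complex \<Rightarrow> complex" where
  "hyperbolic_laplacian f z =
     - (of_real (Im z))\<^sup>2 * (partial_x (partial_x f) z + partial_y (partial_y f) z)"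

text \<open>
  A Maass cusp form for SL(2,Z) with Laplace eigenvalue \<open>1/4 + \<nu>\<^sup>2\<close>. The fourth condition is
  moderate growth at the cusp, the last one the vanishing of the constant term.
\<close>

definition maass_cusp_form :: "complex \<Rightarrow> (complex \<Rightarrow> complex) \<Rightarrow> bool" where
  "maass_cusp_form \<nu> f \<longleftrightarrow>
     smooth_on_uhp f \<and> modular_of_weight 0 f \<and>
     (\<forall>z\<in>upper_half_plane. hyperbolic_laplacian f z = (1/4 + \<nu>\<^sup>2) * f z) \<and>
     (\<exists>C N. \<forall>z. Im z \<ge> 1 \<longrightarrow> norm (f z) \<le> C * Im z powr N) \<and>
     (\<forall>y>0. ((\<lambda>x. f (Complex x y)) has_integral 0) {0..1})"

definition maass_hecke_operator ::
    "nat \<Rightarrow> (complex \<Rightarrow> complex) \<Rightarrow> complex \<Rightarrow> complex" where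
  "maass_hecke_operator n f z =
     (\<Sum>d | d dvd n. \<Sum>b<d. f ((of_nat (n div d) * z + of_nat b) / of_nat d)) / of_real (sqrt (real n))"

definition hecke_maass_cusp_form :: "complex \<Rightarrow> (complex \<Rightarrow> complex) \<Rightarrow> bool" where
  "hecke_maass_cusp_form \<nu> f \<longleftrightarrow>
     maass_cusp_form \<nu> f \<and>
     (\<forall>n\<ge>1. \<exists>c. \<forall>z\<in>upper_half_plane. maass_hecke_operator n f z = c * f z)"

text \<open>
  The \<open>K\<close>-Bessel function of complex order \<open>s\<close> at \<open>y > 0\<close>, by its classical integral
  representation \<open>K\<^sub>s(y) = \<integral>\<^sub>0\<^sup>\<infinity> exp(-y cosh t) cosh(s t) dt\<close>, which converges absolutely.
\<close>

definition bessel_K :: "complex \<Rightarrow> real \<Rightarrow> complex" where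
  "bessel_K s y = integral {0..} (\<lambda>t. of_real (exp (- y * cosh t)) * cosh (s * of_real t))"

definition maass_fourier_coeffs ::
    "complex \<Rightarrow> (complex \<Rightarrow> complex) \<Rightarrow> (int \<Rightarrow> complex) \<Rightarrow> bool" where
  "maass_fourier_coeffs \<nu> f A \<longleftrightarrow>
     (\<forall>z\<in>upper_half_plane.
        ((\<lambda>n. of_real (2 * sqrt (Im z)) *
              (A n * bessel_K (\<i> * \<nu>) (2 * pi * \<bar>real_of_int n\<bar> * Im z) *
               e_fun (of_int n * of_real (Re z))))
           has_sum f z) {n. n \<noteq> 0})"


subsection \<open>Primitive forms together with their normalized Fourier coefficients\<close>

definition primitive_hecke_form :: "(complex \<Rightarrow> complex) \<Rightarrow> (int \<Rightarrow> complex) \<Rightarrow> bool" where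
  "primitive_hecke_form f A \<longleftrightarrow>
     A 1 = 1 \<and>
     ((\<exists>\<kappa>. holomorphic_hecke_cusp_form \<kappa> f \<and> holomorphic_fourier_coeffs \<kappa> f A) \<or>
      (\<exists>\<nu>. hecke_maass_cusp_form \<nu> f \<and> maass_fourier_coeffs \<nu> f A))"

end

theory Submission
  imports Defs
begin

text \<open>
  For fixed \<open>m\<close> the sum over \<open>n\<close> runs over the coefficients \<open>A j\<close> with \<open>j\<close> in an interval of length at
  most \<open>X\<close> contained in \<open>[2 X, 4 X]\<close>. Wilton's method bounds such a sum by \<open>O(sqrt X log X)\<close>, and there
  are \<open>O(X powr (1/k))\<close> values of \<open>m\<close>. This saves nearly \<open>X powr (1/2)\<close> over the number of terms,
  while the claimed saving is \<open>1/(4 k) + 1/2 ^ (l+4) \<le> 1/8 + 1/32 < 1/4\<close>, because \<open>k \<ge> 2\<close> and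
  \<open>l \<ge> 1\<close>. So no cancellation between different \<open>m\<close> is required, and the logarithm is absorbed
  by the spare quarter power.

  Wilton's bound has three ingredients. The function \<open>Im z powr (\<kappa>/2) * \<bar>f z\<bar>\<close> (with \<open>\<kappa> = 0\<close> for a
  Maass form) is bounded on the whole upper half plane: it is invariant under the modular group,
  so it is enough to bound it near the cusp, where the Fourier series decays exponentially
  (\<open>modular_form_scaled_bounded\<close>). On a horizontal line of height comparable to \<open>1/X\<close>, the form is
  an absolutely convergent trigonometric series bounded by \<open>O(X powr (\<kappa>/2))\<close>, and a block of
  consecutive coefficients of a bounded trigonometric series is bounded up to a logarithm, which
  is the \<open>L\<^sup>1\<close> norm of the Dirichlet kernel (\<open>norm_sum_fourier_coeffs_le\<close>). These coefficients
  are \<open>A n\<close> times a weight \<open>\<phi> (n/X)\<close>; since \<open>\<phi>\<close> is Lipschitz and does not vanish on \<open>[2, 4]\<close>,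
  summation by parts removes it (\<open>remove_weight\<close>).

  In the holomorphic case \<open>\<phi>\<close> is a power times an exponential. In the Maass case \<open>\<phi>\<close> is a
  \<open>K\<close>-Bessel function, which may vanish at small arguments; the height of the line is
  therefore taken as a large multiple of \<open>1/X\<close>, where the Bessel function of order \<open>s\<close> is
  comparable to that of order \<open>0\<close> (\<open>bessel_K_near_bessel_K0\<close>). The same comparison gives the
  exponential decay at the cusp.
\<close>

section \<open>Blocks of Fourier coefficients of a bounded series\<close>

text \<open>
  Concavity of the sine: its graph lies above the chord from \<open>0\<close> to \<open>\<pi>/2\<close>.
\<close>

lemma sin_pi_ge_double:
  fixes x :: real
  assumes "0 \<le> x" "x \<le> 1/2"
  shows "2 * x \<le> sin (pi * x)"
proof -
  have "concave_on {0..pi/2} sin"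
  proof (rule f''_le0_imp_concave)
    show "(sin has_real_derivative cos x) (at x)" for x :: real
      by (rule DERIV_sin)
    show "(cos has_real_derivative - sin x) (at x)" for x :: real
      by (rule DERIV_cos)
    show "- sin x \<le> 0" if "x \<in> {0..pi/2}" for x :: real
      using that sin_ge_zero[of x] by auto
  qed auto
  from concave_onD_Icc[OF this, of "2 * x"] show ?thesis
    using assms by (simp add: mult.commute)
qed

text \<open>
  The frequencies are negated so that integrating a trigonometric polynomial against the kernel
  adds up its coefficients with indices \<open>a, \<dots>, a + N - 1\<close>.
\<close>

definition dirichlet_kernel :: "int \<Rightarrow> nat \<Rightarrow> real \<Rightarrow> complex" where
  "dirichlet_kernel a N x = (\<Sum>j<N. cis (- 2 * pi * of_int (a + int j) * x))"

lemma norm_dirichlet_kernel_le_card: "norm (dirichlet_kernel a N x) \<le> N"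
  unfolding dirichlet_kernel_def by (rule order_trans[OF norm_sum]) simp

text \<open>
  The kernel is a geometric sum, and \<open>2 \<bar>sin (\<pi> x)\<bar>\<close> is the distance of its ratio from \<open>1\<close>.
\<close>

lemma norm_dirichlet_kernel_sin_le:
  "\<bar>sin (pi * x)\<bar> * norm (dirichlet_kernel a N x) \<le> 1"
proof -
  let ?q = "cis (- 2 * pi * x)"
  have "dirichlet_kernel a N x = cis (- 2 * pi * of_int a * x) * (\<Sum>j<N. ?q ^ j)"
    unfolding dirichlet_kernel_def sum_distrib_left Complex.DeMoivre cis_mult
    by (intro sum.cong refl arg_cong[of _ _ cis]) (simp add: algebra_simps)
  hence "norm (1 - ?q) * norm (dirichlet_kernel a N x) = norm (1 - ?q ^ N)"
    by (simp add: norm_mult one_diff_power_eq)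
  also have "\<dots> \<le> 2"
    by (rule order_trans[OF norm_triangle_ineq4]) (simp add: norm_power)
  finally have "norm (1 - ?q) * norm (dirichlet_kernel a N x) \<le> 2" .
  moreover have "norm (1 - ?q) = 2 * \<bar>sin (pi * x)\<bar>"
    using dist_exp_i_1[of "- 2 * pi * x"]
    by (simp add: cis_conv_exp norm_minus_commute mult_ac)
  ultimately show ?thesis by simp
qed

text \<open>
  The trivial bound \<open>N\<close> and the geometric bound \<open>1/(2 x)\<close> combine into one expression with an
  elementary antiderivative. The point \<open>y\<close> is \<open>x\<close> or \<open>1 - x\<close>, so that both ends of the period
  are covered.
\<close>

lemma norm_dirichlet_kernel_le_half:
  assumes "0 \<le> x" "x \<le> 1/2" "\<bar>sin (pi * y)\<bar> = sin (pi * x)"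
  shows "norm (dirichlet_kernel a N y) \<le> 2 * real N / (1 + real N * x)"
proof -
  let ?D = "norm (dirichlet_kernel a N y)"
  have "2 * x * ?D \<le> sin (pi * x) * ?D"
    by (intro mult_right_mono sin_pi_ge_double assms) auto
  also have "\<dots> \<le> 1"
    using norm_dirichlet_kernel_sin_le[of y a N] assms by simp
  finally have 1: "x * ?D \<le> 1/2" by simp
  have "N * (x * ?D) \<le> N * (1/2)"
    by (intro mult_left_mono 1) auto
  hence "?D * (1 + N * x) \<le> 2 * N"
    using norm_dirichlet_kernel_le_card[of a N y] by (simp add: algebra_simps)
  moreover have "1 + real N * x > 0" using assms by (simp add: add_pos_nonneg)
  ultimately show ?thesis by (simp add: field_simps)
qed

lemma norm_dirichlet_kernel_le:
  assumes "0 \<le> x" "x \<le> 1"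
  shows "norm (dirichlet_kernel a N x) \<le> 2 * real N / (1 + real N * x) + 2 * real N / (1 + real N * (1 - x))"
proof -
  have nn: "2 * real N / (1 + real N * x) \<ge> 0" "2 * real N / (1 + real N * (1 - x)) \<ge> 0"
    using assms by (auto intro!: divide_nonneg_nonneg add_nonneg_nonneg)
  show ?thesis
  proof (cases "x \<le> 1/2")
    case True
    have "\<bar>sin (pi * x)\<bar> = sin (pi * x)"
      using sin_pi_ge_double[of x] assms True by simp
    from norm_dirichlet_kernel_le_half[OF assms(1) True this] nn(2)
    show ?thesis by (meson add_increasing2)
  next
    case False
    have "sin (pi * x) = sin (pi * (1 - x))"
      by (simp add: algebra_simps)
    hence "\<bar>sin (pi * x)\<bar> = sin (pi * (1 - x))"
      using sin_pi_ge_double[of "1 - x"] assms False by simp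
    have "norm (dirichlet_kernel a N x) \<le> 2 * real N / (1 + real N * (1 - x))"
      by (rule norm_dirichlet_kernel_le_half) (use assms False \<open>\<bar>sin (pi * x)\<bar> = _\<close> in auto)
    with nn(1) show ?thesis by linarith
  qed
qed

lemma has_integral_dirichlet_majorant:
  fixes N :: nat
  shows "((\<lambda>x. 2 * real N / (1 + real N * x) + 2 * real N / (1 + real N * (1 - x))) has_integral (4 * ln (1 + real N))) {0..1}"
proof -
  let ?F = "\<lambda>x::real. 2 * ln (1 + real N * x) - 2 * ln (1 + real N * (1 - x))"
  have "((\<lambda>x. 2 * real N / (1 + real N * x) + 2 * real N / (1 + real N * (1 - x))) has_integral (?F 1 - ?F 0)) {0..1}"
  proof (rule fundamental_theorem_of_calculus)
    fix x :: real assume x: "x \<in> {0..1}"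
    have "1 + real N * x > 0" "1 + real N * (1 - x) > 0"
      using x by (auto intro!: add_pos_nonneg)
    thus "(?F has_vector_derivative 2 * real N / (1 + real N * x) + 2 * real N / (1 + real N * (1 - x))) (at x within {0..1})"
      unfolding has_real_derivative_iff_has_vector_derivative[symmetric]
      by (auto intro!: derivative_eq_intros simp: field_simps)
  qed auto
  thus ?thesis by simp
qed

lemma has_integral_cis_int:
  fixes n :: int
  shows "((\<lambda>x. cis (2 * pi * n * x)) has_integral (if n = 0 then 1 else 0)) {0..1}"
proof (cases "n = 0")
  case True
  thus ?thesis using has_integral_const_real[of "1::complex" 0 1] by simp
next
  case False
  let ?F = "\<lambda>x. cis (2 * pi * n * x) / (\<i> * (2 * pi * n))"
  have "((\<lambda>x. cis (2 * pi * n * x)) has_integral (?F 1 - ?F 0)) {0..1}"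
  proof (rule fundamental_theorem_of_calculus)
    fix x :: real
    show "(?F has_vector_derivative cis (2 * pi * n * x)) (at x within {0..1})"
    proof -
      let ?G = "\<lambda>z. exp (\<i> * (2 * pi * n) * z) / (\<i> * (2 * pi * n))"
      have "(?G has_field_derivative cis (2 * pi * n * x)) (at (of_real x))"
        using False by (auto intro!: derivative_eq_intros simp: cis_conv_exp mult_ac)
      from has_vector_derivative_real_field[OF this] show ?thesis
        by (simp add: cis_conv_exp mult_ac)
    qed
  qed auto
  moreover have "cis (2 * pi * n) = 1"
    using cis_multiple_2pi[of "of_int n"] by simp
  ultimately show ?thesis using False by simp
qed

lemma sum_int_interval_shift:
  fixes g :: "int \<Rightarrow> 'a::comm_monoid_add"
  shows "(\<Sum>i<N. g (a + int i)) = (\<Sum>n=a..a + int N - 1. g n)"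
  by (rule sum.reindex_bij_witness[where i = "\<lambda>n. nat (n - a)" and j = "\<lambda>i. a + int i"]) auto

text \<open>
  Integrating the polynomial against the Dirichlet kernel extracts the block of coefficients
  exactly, so the supremum of the polynomial times the \<open>L\<^sup>1\<close> norm of the kernel is a bound. The
  argument of the logarithm is one more than the length of the block; the absolute value keeps
  it positive for an empty block.
\<close>

lemma norm_sum_coeffs_interval_le:
  fixes c :: "int \<Rightarrow> complex"
  assumes "finite F" "{a..b} \<subseteq> F"
    and bound: "\<And>x::real. norm (\<Sum>n\<in>F. c n * cis (2 * pi * n * x)) \<le> B"
  shows "norm (\<Sum>n=a..b. c n) \<le> 4 * B * ln (2 + real_of_int \<bar>b - a\<bar>)"
proof (cases "a \<le> b")
  case False
  have "B \<ge> 0" using bound[of 0] norm_ge_zero by (rule order_trans[rotated])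
  thus ?thesis using False by simp
next
  case True
  define N where "N = nat (b - a + 1)"
  have N: "a + int N - 1 = b" using True by (simp add: N_def)
  define P where "P x = (\<Sum>n\<in>F. c n * cis (2 * pi * n * x))" for x :: real
  have kernel: "dirichlet_kernel a N x = (\<Sum>m=a..b. cis (- 2 * pi * m * x))" for x
    unfolding dirichlet_kernel_def
    using sum_int_interval_shift[of "\<lambda>m. cis (- 2 * pi * m * x)" a N] by (simp only: N)
  have "((\<lambda>x. P x * dirichlet_kernel a N x) has_integral (\<Sum>m=a..b. c m)) {0..1}"
  proof -
    have "((\<lambda>x. \<Sum>m=a..b. \<Sum>n\<in>F. c n * cis (2 * pi * (n - m) * x)) has_integral
            (\<Sum>m=a..b. \<Sum>n\<in>F. c n * (if n - m = 0 then 1 else 0))) {0..1}"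
      using assms(1)
      by (intro has_integral_sum has_integral_mult_right has_integral_cis_int) auto
    also have "(\<Sum>m=a..b. \<Sum>n\<in>F. c n * (if n - m = 0 then 1 else 0)) = (\<Sum>m=a..b. c m)"
    proof (intro sum.cong refl)
      fix m assume "m \<in> {a..b}"
      hence "m \<in> F" using assms(2) by auto
      have "(\<Sum>n\<in>F. c n * (if n - m = 0 then 1 else 0)) = (\<Sum>n\<in>F. if m = n then c n else 0)"
        by (intro sum.cong) auto
      also have "\<dots> = c m"
        using assms(1) \<open>m \<in> F\<close> by simp
      finally show "(\<Sum>n\<in>F. c n * (if n - m = 0 then 1 else 0)) = c m" .
    qed
    also have "(\<lambda>x. \<Sum>m=a..b. \<Sum>n\<in>F. c n * cis (2 * pi * (n - m) * x)) =
               (\<lambda>x. P x * dirichlet_kernel a N x)"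
    proof
      fix x
      have "P x * dirichlet_kernel a N x =
              (\<Sum>m=a..b. \<Sum>n\<in>F. c n * cis (2 * pi * n * x) * cis (- 2 * pi * m * x))"
        unfolding P_def kernel sum_product by (rule sum.swap)
      also have "\<dots> = (\<Sum>m=a..b. \<Sum>n\<in>F. c n * cis (2 * pi * (n - m) * x))"
        by (intro sum.cong refl) (simp add: mult.assoc cis_mult ring_distribs left_diff_distrib)
      finally show "(\<Sum>m=a..b. \<Sum>n\<in>F. c n * cis (2 * pi * (n - m) * x)) = P x * dirichlet_kernel a N x" ..
    qed
    finally show ?thesis .
  qed
  hence int: "integral {0..1} (\<lambda>x. P x * dirichlet_kernel a N x) = (\<Sum>m=a..b. c m)"
    "(\<lambda>x. P x * dirichlet_kernel a N x) integrable_on {0..1}"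
    by (auto simp: has_integral_iff)
  let ?M = "\<lambda>x. B * (2 * real N / (1 + real N * x) + 2 * real N / (1 + real N * (1 - x)))"
  have M: "(?M has_integral (B * (4 * ln (1 + real N)))) {0..1}"
    by (intro has_integral_mult_right has_integral_dirichlet_majorant)
  have "norm (integral {0..1} (\<lambda>x. P x * dirichlet_kernel a N x)) \<le> integral {0..1} ?M"
  proof (rule integral_norm_bound_integral)
    show "?M integrable_on {0..1}" using M by blast
    fix x :: real assume "x \<in> {0..1}"
    thus "norm (P x * dirichlet_kernel a N x) \<le> ?M x"
      unfolding norm_mult using bound[of x] norm_dirichlet_kernel_le[of x a N]
      by (intro mult_mono) (auto simp: P_def intro: order_trans[OF norm_ge_zero])
  qed (fact int)
  also have "\<dots> = 4 * B * ln (1 + real N)"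
    using M by (simp add: has_integral_iff)
  also have "1 + real N = 2 + real_of_int \<bar>b - a\<bar>"
    using True by (simp add: N_def)
  finally show ?thesis by (simp only: int)
qed

text \<open>
  Absolute convergence gives a finite partial sum that contains the block and differs from \<open>g\<close> by
  at most \<open>\<delta>\<close> at all points simultaneously; the bound for polynomials then applies with
  \<open>B + \<delta>\<close>, and \<open>\<delta>\<close> is arbitrary. In this way \<open>g\<close> itself never has to be integrated.
\<close>

lemma norm_sum_fourier_coeffs_le:
  fixes c :: "int \<Rightarrow> complex"
  assumes series: "\<And>x::real. ((\<lambda>n. c n * cis (2 * pi * n * x)) has_sum g x) S"
    and bound: "\<And>x. norm (g x) \<le> B"
    and S: "{a..b} \<subseteq> S"
  shows "norm (\<Sum>n=a..b. c n) \<le> 4 * B * ln (2 + real_of_int \<bar>b - a\<bar>)"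
proof (rule field_le_epsilon)
  fix e :: real assume e: "e > 0"
  define L where "L = ln (2 + real_of_int \<bar>b - a\<bar>)"
  have L: "L > 0" by (auto simp: L_def intro!: ln_gt_zero)
  define \<delta> where "\<delta> = e / (4 * L)"
  have \<delta>: "\<delta> > 0" using e L by (simp add: \<delta>_def)
  have "c summable_on S" using has_sum_imp_summable[OF series[of 0]] by simp
  hence "(\<lambda>n. norm (c n)) summable_on S"
    by (simp add: summable_on_iff_abs_summable_on_complex)
  then obtain T where T: "((\<lambda>n. norm (c n)) has_sum T) S"
    using summable_on_def by blast
  from has_sum_finite_approximation[OF this \<delta>] obtain F0
    where F0: "finite F0" "F0 \<subseteq> S" "dist (\<Sum>n\<in>F0. norm (c n)) T \<le> \<delta>" by blast
  define F where "F = F0 \<union> {a..b}"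
  have F: "finite F" "F \<subseteq> S" "{a..b} \<subseteq> F" using F0 S by (auto simp: F_def)
  have tail: "T - (\<Sum>n\<in>F. norm (c n)) \<le> \<delta>"
  proof -
    have "(\<Sum>n\<in>F0. norm (c n)) \<le> (\<Sum>n\<in>F. norm (c n))"
      by (rule sum_mono2) (auto simp: F_def F0)
    thus ?thesis using F0(3) by (simp add: dist_real_def)
  qed
  have tail_sum: "((\<lambda>n. norm (c n)) has_sum (T - (\<Sum>n\<in>F. norm (c n)))) (S - F)"
    by (intro has_sum_Diff T has_sum_finite F)
  have "norm (\<Sum>n\<in>F. c n * cis (2 * pi * n * x)) \<le> B + \<delta>" for x :: real
  proof -
    let ?P = "\<Sum>n\<in>F. c n * cis (2 * pi * n * x)"
    have "((\<lambda>n. c n * cis (2 * pi * n * x)) has_sum (g x - ?P)) (S - F)"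
      by (intro has_sum_Diff series has_sum_finite F)
    hence "norm (g x - ?P) \<le> T - (\<Sum>n\<in>F. norm (c n))"
      by (rule norm_infsum_le[OF _ tail_sum]) (simp add: norm_mult)
    with tail have "norm (g x - ?P) \<le> \<delta>" by simp
    with bound[of x] show ?thesis
      using norm_triangle_ineq2[of ?P "g x"] by (simp add: norm_minus_commute)
  qed
  from norm_sum_coeffs_interval_le[OF F(1,3) this]
  have "norm (\<Sum>n=a..b. c n) \<le> 4 * (B + \<delta>) * L" by (simp add: L_def)
  also have "\<dots> = 4 * B * L + e" using L by (simp add: \<delta>_def field_simps)
  finally show "norm (\<Sum>n=a..b. c n) \<le> 4 * B * ln (2 + real_of_int \<bar>b - a\<bar>) + e"
    by (simp add: L_def)
qed

section \<open>Removing a weight by partial summation\<close>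

text \<open>
  Abel summation: \<open>P\<close> bounds the partial sums of \<open>u\<close>, and \<open>W + N * V\<close> bounds the last weight plus
  the total variation of the weights.
\<close>

lemma norm_summation_by_parts_le:
  fixes u :: "nat \<Rightarrow> complex" and w :: "nat \<Rightarrow> complex"
  assumes part: "\<And>j. j \<le> N \<Longrightarrow> norm (\<Sum>i<j. u i) \<le> P"
    and W: "\<And>i. i < N \<Longrightarrow> norm (w i) \<le> W"
    and V: "\<And>i. Suc i < N \<Longrightarrow> norm (w (Suc i) - w i) \<le> V"
    and nn: "W \<ge> 0" "V \<ge> 0"
  shows "norm (\<Sum>i<N. u i * w i) \<le> P * (W + N * V)"
proof (cases N)
  case 0
  thus ?thesis using part[of 0] nn by simp
next
  case (Suc M)
  define U where "U j = (\<Sum>i<j. u i)" for j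
  have P: "P \<ge> 0" using part[of 0] by simp
  have parts: "(\<Sum>i<Suc m. u i * w i) = U (Suc m) * w m - (\<Sum>i<m. U (Suc i) * (w (Suc i) - w i))" for m
    by (induction m) (simp_all add: U_def algebra_simps)
  have "norm (\<Sum>i<N. u i * w i) \<le>
          norm (U (Suc M) * w M) + norm (\<Sum>i<M. U (Suc i) * (w (Suc i) - w i))"
    unfolding Suc parts by (rule norm_triangle_ineq4)
  also have "norm (U (Suc M) * w M) \<le> P * W"
    unfolding norm_mult U_def using Suc P by (intro mult_mono part W) auto
  also have "norm (\<Sum>i<M. U (Suc i) * (w (Suc i) - w i)) \<le> (\<Sum>i<M. P * V)"
    unfolding U_def using Suc P
    by (intro sum_norm_le) (auto simp: norm_mult intro!: mult_mono part V simp del: sum.lessThan_Suc)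
  also have "(\<Sum>i<M. P * V) \<le> P * (N * V)"
    using Suc P nn by (simp add: mult_left_mono mult_ac)
  finally show ?thesis by (simp add: algebra_simps)
qed

lemma lipschitz_inverse_weight:
  fixes \<phi> :: "real \<Rightarrow> complex"
  assumes lip: "L-lipschitz_on {2..4} \<phi>" and nz: "\<And>t. t \<in> {2..4} \<Longrightarrow> \<phi> t \<noteq> 0"
  obtains W V where "W > 0" "V \<ge> 0" "\<And>t. t \<in> {2..4} \<Longrightarrow> norm (1 / \<phi> t) \<le> W"
    "\<And>s t. s \<in> {2..4} \<Longrightarrow> t \<in> {2..4} \<Longrightarrow> norm (1 / \<phi> s - 1 / \<phi> t) \<le> V * \<bar>s - t\<bar>"
proof -
  have "continuous_on {2..4} (\<lambda>t. 1 / \<phi> t)"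
    using lipschitz_on_continuous_on[OF lip] nz by (intro continuous_intros) auto
  hence "bounded ((\<lambda>t. 1 / \<phi> t) ` {2..4})"
    by (intro compact_imp_bounded compact_continuous_image) auto
  then obtain W where W: "W > 0" "\<And>t. t \<in> {2..4} \<Longrightarrow> norm (1 / \<phi> t) \<le> W"
    unfolding bounded_pos by blast
  have L: "L \<ge> 0" by (rule lipschitz_on_nonneg[OF lip])
  have "norm (1 / \<phi> s - 1 / \<phi> t) \<le> W * W * L * \<bar>s - t\<bar>" if st: "s \<in> {2..4}" "t \<in> {2..4}" for s t
  proof -
    have "1 / \<phi> s - 1 / \<phi> t = (1 / \<phi> s) * (1 / \<phi> t) * (\<phi> t - \<phi> s)"
      using nz[OF st(1)] nz[OF st(2)] by (simp add: field_simps)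
    also have "norm \<dots> \<le> W * W * (L * \<bar>s - t\<bar>)"
      unfolding norm_mult
      using W L st lipschitz_onD[OF lip st(2,1)]
      by (intro mult_mono) (auto simp: dist_norm abs_minus_commute)
    finally show ?thesis by (simp add: mult.assoc)
  qed
  thus thesis using W L by (intro that[of W "W * W * L"]) auto
qed

text \<open>
  Dividing by the weight costs a constant factor: over at most \<open>2 X\<close> steps of length \<open>1/X\<close> the
  function \<open>1/\<phi>\<close>, bounded and Lipschitz on \<open>[2, 4]\<close>, has bounded total variation.
\<close>

lemma remove_weight:
  fixes A :: "int \<Rightarrow> complex" and \<phi> :: "real \<Rightarrow> complex"
  assumes lip: "L-lipschitz_on {2..4} \<phi>" and nz: "\<And>t. t \<in> {2..4} \<Longrightarrow> \<phi> t \<noteq> 0"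
    and weighted: "\<And>X a b. X \<ge> 1 \<Longrightarrow> a \<ge> 1 \<Longrightarrow>
       norm (\<Sum>n=a..b. A n * \<phi> (n / X)) \<le> C * sqrt X * ln (2 + real_of_int \<bar>b - a\<bar>)"
  shows "\<exists>K\<ge>0. \<forall>X\<ge>1. \<forall>a b. 2 * X \<le> of_int a \<longrightarrow> of_int b \<le> 4 * X \<longrightarrow> of_int (b - a) \<le> X \<longrightarrow>
           norm (\<Sum>n=a..b. A n) \<le> K * sqrt X * ln (2 + X)"
proof -
  obtain W V where WV: "W > 0" "V \<ge> 0" "\<And>t. t \<in> {2..4} \<Longrightarrow> norm (1 / \<phi> t) \<le> W"
    "\<And>s t. s \<in> {2..4} \<Longrightarrow> t \<in> {2..4} \<Longrightarrow> norm (1 / \<phi> s - 1 / \<phi> t) \<le> V * \<bar>s - t\<bar>"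
    using lipschitz_inverse_weight[OF lip nz] by metis
  have C: "C \<ge> 0"
  proof -
    have "0 \<le> C * sqrt 1 * ln (2 + real_of_int \<bar>1 - 1\<bar>)"
      using weighted[of 1 1 1] by (rule order_trans[OF norm_ge_zero]) simp_all
    moreover have "ln (2::real) > 0" by simp
    ultimately show ?thesis by (simp add: zero_le_mult_iff)
  qed
  have "norm (\<Sum>n=a..b. A n) \<le> C * (W + 2 * V) * sqrt X * ln (2 + X)"
    if X: "X \<ge> 1" and ab: "2 * X \<le> of_int a" "of_int b \<le> 4 * X" "of_int (b - a) \<le> X"
    for X :: real and a b :: int
  proof (cases "a \<le> b")
    case False
    thus ?thesis using C WV X by (simp add: ln_ge_zero)
  next
    case True
    define N where "N = nat (b - a + 1)"
    have N: "a + int N - 1 = b" "real N \<le> 2 * X" using True ab(3) X by (auto simp: N_def)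
    have a: "a \<ge> 1" using X ab(1) by linarith
    define x where "x i = (of_int (a + int i) / X :: real)" for i
    have x: "x i \<in> {2..4}" if "i < N" for i
    proof -
      have "of_int a \<le> (of_int (a + int i) :: real)" "of_int (a + int i) \<le> (of_int b :: real)"
        using that N(1) unfolding of_int_le_iff by linarith+
      thus ?thesis using ab X by (auto simp: x_def field_simps)
    qed
    have "norm (\<Sum>i<N. (A (a + int i) * \<phi> (x i)) * (1 / \<phi> (x i))) \<le>
            (C * sqrt X * ln (2 + X)) * (W + N * (V / X))"
    proof (rule norm_summation_by_parts_le)
      fix j assume j: "j \<le> N"
      have "(\<Sum>i<j. A (a + int i) * \<phi> (x i)) = (\<Sum>n=a..a + int j - 1. A n * \<phi> (n / X))"
        unfolding x_def by (rule sum_int_interval_shift)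
      also have "norm \<dots> \<le> C * sqrt X * ln (2 + real_of_int \<bar>(a + int j - 1) - a\<bar>)"
        by (rule weighted[OF X a])
      also have "\<dots> \<le> C * sqrt X * ln (2 + X)"
      proof (intro mult_left_mono)
        \<comment> \<open>the empty partial sum \<open>j = 0\<close> gives the absolute value \<open>1\<close>, hence the maximum\<close>
        have "\<bar>(a + int j - 1) - a\<bar> \<le> max 1 (b - a)" using j N(1) by linarith
        hence "real_of_int \<bar>(a + int j - 1) - a\<bar> \<le> X"
          using ab(3) X by linarith
        thus "ln (2 + real_of_int \<bar>(a + int j - 1) - a\<bar>) \<le> ln (2 + X)" by simp
      qed (use C X in auto)
      finally show "norm (\<Sum>i<j. A (a + int i) * \<phi> (x i)) \<le> C * sqrt X * ln (2 + X)" .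
    next
      fix i assume "i < N"
      thus "norm (1 / \<phi> (x i)) \<le> W" using x WV(3) by blast
    next
      fix i assume i: "Suc i < N"
      have "norm (1 / \<phi> (x (Suc i)) - 1 / \<phi> (x i)) \<le> V * \<bar>x (Suc i) - x i\<bar>"
        using i by (intro WV(4) x) auto
      also have "\<bar>x (Suc i) - x i\<bar> = 1 / X"
        using X by (simp add: x_def flip: diff_divide_distrib)
      finally show "norm (1 / \<phi> (x (Suc i)) - 1 / \<phi> (x i)) \<le> V / X" by simp
    qed (use WV X in auto)
    also have "(\<Sum>i<N. (A (a + int i) * \<phi> (x i)) * (1 / \<phi> (x i))) = (\<Sum>i<N. A (a + int i))"
      using nz x by (intro sum.cong) auto
    also have "\<dots> = (\<Sum>n=a..b. A n)"
      using sum_int_interval_shift[of A a N] N(1) by simp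
    also have "(C * sqrt X * ln (2 + X)) * (W + N * (V / X)) \<le> (C * sqrt X * ln (2 + X)) * (W + 2 * V)"
    proof (intro mult_left_mono add_left_mono)
      have "N * (V / X) \<le> (2 * X) * (V / X)"
        using N(2) WV X by (intro mult_right_mono) auto
      thus "N * (V / X) \<le> 2 * V" using X by simp
      show "0 \<le> C * sqrt X * ln (2 + X)" using C X by (simp add: ln_ge_zero)
    qed
    finally show ?thesis by (simp add: mult_ac)
  qed
  thus ?thesis using C WV by (intro exI[of _ "C * (W + 2 * V)"]) auto
qed

section \<open>Boundedness of modular invariant functions\<close>

text \<open>
  Reduction to a neighbourhood of the fundamental domain, as an induction principle. After a
  translation \<open>\<bar>Re z\<bar> \<le> 1/2\<close>; if then \<open>Im z < 1/2\<close>, we have \<open>\<bar>z\<bar>\<^sup>2 \<le> 1/2\<close>, and the inversion at least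
  doubles the imaginary part. Hence finitely many steps lead to \<open>Im z \<ge> 1/2\<close>.
\<close>

lemma upper_half_plane_reduction:
  assumes T: "\<And>z. Im z > 0 \<Longrightarrow> P (z + 1) \<Longrightarrow> P z" "\<And>z. Im z > 0 \<Longrightarrow> P (z - 1) \<Longrightarrow> P z"
    and S: "\<And>z. Im z > 0 \<Longrightarrow> P (- 1 / z) \<Longrightarrow> P z"
    and base: "\<And>z. Im z \<ge> 1/2 \<Longrightarrow> \<bar>Re z\<bar> \<le> 1/2 \<Longrightarrow> P z"
    and z: "Im z > 0"
  shows "P z"
proof -
  have up: "P (z + of_nat n) \<Longrightarrow> P z" if "Im z > 0" for z n
    using that
  proof (induction n arbitrary: z)
    case (Suc n)
    have "P (z + 1)"
      using Suc.IH[of "z + 1"] Suc.prems by (simp add: add_ac)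
    thus ?case using T(1) Suc.prems by blast
  qed simp
  have down: "P (z - of_nat n) \<Longrightarrow> P z" if "Im z > 0" for z n
    using that
  proof (induction n arbitrary: z)
    case (Suc n)
    have "P (z - 1)"
      using Suc.IH[of "z - 1"] Suc.prems by (simp add: algebra_simps)
    thus ?case using T(2) Suc.prems by blast
  qed simp
  have shift: "P (z + of_int n) \<Longrightarrow> P z" if "Im z > 0" for z n
    using up[OF that, of "nat n"] down[OF that, of "nat (- n)"]
    by (cases "n \<ge> 0") simp_all
  have strip: "\<exists>n::int. \<bar>Re (z + of_int n)\<bar> \<le> 1/2" for z
    using of_int_round_abs_le[of "Re z"] by (intro exI[of _ "- round (Re z)"]) (simp add: abs_minus_commute)
  have "2 ^ k * Im z \<ge> 1/2 \<Longrightarrow> P z" if "Im z > 0" for k z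
    using that
  proof (induction k arbitrary: z)
    case 0
    obtain n :: int where "\<bar>Re (z + of_int n)\<bar> \<le> 1/2" using strip by blast
    thus ?case using base[of "z + of_int n"] shift[of z n] 0 by simp
  next
    case (Suc k)
    obtain n :: int where n: "\<bar>Re (z + of_int n)\<bar> \<le> 1/2" using strip by blast
    define w where "w = z + of_int n"
    have w: "Im w > 0" "\<bar>Re w\<bar> \<le> 1/2" "Im w = Im z" using n Suc.prems by (auto simp: w_def)
    have "P w"
    proof (cases "Im w \<ge> 1/2")
      case True
      thus ?thesis using base w by blast
    next
      case False
      have sq: "(Re w)\<^sup>2 + (Im w)\<^sup>2 \<le> 1/2"
        using power_mono[of "\<bar>Re w\<bar>" "1/2" 2] power_mono[of "Im w" "1/2" 2] w False
        by (simp add: power2_eq_square)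
      have pos: "(Re w)\<^sup>2 + (Im w)\<^sup>2 > 0"
        using w(1) by (simp add: add_nonneg_pos)
      have Im: "Im (- 1 / w) = Im w / ((Re w)\<^sup>2 + (Im w)\<^sup>2)"
        by (simp add: Im_divide)
      have "2 * Im w \<le> Im (- 1 / w)"
        unfolding Im using sq pos w(1) mult_left_mono[OF sq, of "2 * Im w"] by (simp add: field_simps)
      hence "2 ^ k * (2 * Im w) \<le> 2 ^ k * Im (- 1 / w)" by (rule mult_left_mono) simp
      hence "P (- 1 / w)"
        using Suc.prems w(1,3) \<open>2 * Im w \<le> Im (- 1 / w)\<close>
        by (intro Suc.IH) (simp add: mult_ac, linarith)
      thus ?thesis using S w(1) by blast
    qed
    thus ?case using shift Suc.prems w_def by blast
  qed
  moreover obtain k where "1 / 2 / Im z < 2 ^ k"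
    using real_arch_pow[of 2] by auto
  hence "2 ^ k * Im z \<ge> 1/2" using z by (simp add: field_simps)
  ultimately show ?thesis using z by blast
qed

text \<open>
  The part of the strip below height \<open>Y\<close> that the reduction can reach is compact, so continuity
  takes care of it, and the rest is the assumption at the cusp.
\<close>

lemma invariant_bounded:
  fixes h :: "complex \<Rightarrow> real"
  assumes cont: "continuous_on {z. Im z > 0} h"
    and T: "\<And>z. Im z > 0 \<Longrightarrow> h (z + 1) = h z"
    and S: "\<And>z. Im z > 0 \<Longrightarrow> h (- 1 / z) = h z"
    and cusp: "\<And>z. Im z \<ge> Y \<Longrightarrow> \<bar>h z\<bar> \<le> M"
  shows "\<exists>B\<ge>0. \<forall>z. Im z > 0 \<longrightarrow> \<bar>h z\<bar> \<le> B"
proof -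
  let ?K = "cbox (Complex (-1/2) (1/2)) (Complex (1/2) Y)"
  have "continuous_on ?K h"
    by (rule continuous_on_subset[OF cont]) (auto simp: in_cbox_complex_iff)
  hence "bounded (h ` ?K)"
    by (intro compact_imp_bounded compact_continuous_image compact_cbox)
  then obtain B0 where B0: "\<And>z. z \<in> ?K \<Longrightarrow> \<bar>h z\<bar> \<le> B0"
    by (auto simp: bounded_iff)
  define B where "B = max 0 (max B0 M)"
  have "\<bar>h z\<bar> \<le> B" if "Im z > 0" for z
  proof (rule upper_half_plane_reduction[of "\<lambda>z. \<bar>h z\<bar> \<le> B"])
    fix z assume "Im z \<ge> 1/2" "\<bar>Re z\<bar> \<le> 1/2"
    hence "z \<in> ?K \<or> Im z \<ge> Y" by (auto simp: in_cbox_complex_iff)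
    hence "\<bar>h z\<bar> \<le> B0 \<or> \<bar>h z\<bar> \<le> M" using B0 cusp by blast
    thus "\<bar>h z\<bar> \<le> B" by (auto simp: B_def)
  next
    fix z assume "Im z > 0" "\<bar>h (z - 1)\<bar> \<le> B"
    thus "\<bar>h z\<bar> \<le> B" using T[of "z - 1"] by simp
  qed (use that T S in auto)
  thus ?thesis by (intro exI[of _ B]) (auto simp: B_def)
qed

lemma modular_of_weight_translate:
  assumes "modular_of_weight \<kappa> f" "Im z > 0"
  shows "f (z + 1) = f z"
  using assms(1)[unfolded modular_of_weight_def, rule_format, where a = 1 and b = 1 and c = 0 and d = 1 and z = z] assms(2)
  by (simp add: upper_half_plane_def)

lemma modular_of_weight_invert:
  assumes "modular_of_weight \<kappa> f" "Im z > 0"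
  shows "f (- 1 / z) = z powi \<kappa> * f z"
  using assms(1)[unfolded modular_of_weight_def, rule_format, where a = 0 and b = "-1" and c = 1 and d = 0 and z = z] assms(2)
  by (simp add: upper_half_plane_def)

lemma modular_form_scaled_bounded:
  assumes f: "modular_of_weight \<kappa> f" "continuous_on upper_half_plane f"
    and cusp: "\<And>z. Im z \<ge> Y \<Longrightarrow> Im z powr (of_int \<kappa> / 2) * norm (f z) \<le> M"
  shows "\<exists>B\<ge>0. \<forall>z. Im z > 0 \<longrightarrow> Im z powr (of_int \<kappa> / 2) * norm (f z) \<le> B"
proof -
  let ?h = "\<lambda>z. Im z powr (of_int \<kappa> / 2) * norm (f z)"
  have "\<exists>B\<ge>0. \<forall>z. Im z > 0 \<longrightarrow> \<bar>?h z\<bar> \<le> B"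
  proof (rule invariant_bounded)
    show "continuous_on {z. Im z > 0} ?h"
      using f(2) by (auto simp: upper_half_plane_def intro!: continuous_intros)
    fix z :: complex assume z: "Im z > 0"
    show "?h (z + 1) = ?h z" using modular_of_weight_translate[OF f(1) z] by simp
    have nz: "norm z > 0" using z by auto
    have "Im (- 1 / z) = Im z / norm z ^ 2"
      by (simp add: Im_divide cmod_power2)
    moreover have "(Im z / norm z ^ 2) powr (of_int \<kappa> / 2) = Im z powr (of_int \<kappa> / 2) / norm z powi \<kappa>"
    proof -
      have "(norm z ^ 2) powr (of_int \<kappa> / 2) = norm z powr of_int \<kappa>"
        using nz by (simp add: powr_powr flip: powr_numeral)
      thus ?thesis using z nz by (simp add: powr_divide powr_real_of_int' power_int_def)
    qed
    ultimately show "?h (- 1 / z) = ?h z"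
      unfolding modular_of_weight_invert[OF f(1) z] using nz
      by (simp add: norm_mult norm_power_int)
  next
    fix z assume "Im z \<ge> Y" thus "\<bar>?h z\<bar> \<le> M" using cusp[of z] by simp
  qed
  thus ?thesis by auto
qed

section \<open>The \<open>K\<close>-Bessel function at large arguments\<close>

text \<open>
  Since \<open>cosh t\<close> grows at least quadratically, \<open>exp (- a cosh t)\<close> beats any exponential:
  completing the square in \<open>(\<sigma> + 1) t - a t\<^sup>2/4\<close> gives the majorant \<open>C exp (- t)\<close>.
\<close>

lemma cosh_weight_integrable:
  fixes g :: "real \<Rightarrow> 'b::euclidean_space"
  assumes a: "a > 0" and cont: "continuous_on {0..} g"
    and bound: "\<And>t. t \<ge> 0 \<Longrightarrow> norm (g t) \<le> M * exp (\<sigma> * t)"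
  shows "(\<lambda>t. exp (- a * cosh t) *\<^sub>R g t) integrable_on {0..}"
proof -
  have M: "M \<ge> 0" using order_trans[OF norm_ge_zero bound[of 0]] by simp
  define C where "C = exp ((\<sigma> + 1)\<^sup>2 / a)"
  have "(\<lambda>t. exp (- a * cosh t) *\<^sub>R g t) absolutely_integrable_on {0..}"
  proof (rule measurable_bounded_by_integrable_imp_absolutely_integrable)
    show "(\<lambda>t. exp (- a * cosh t) *\<^sub>R g t) \<in> borel_measurable (lebesgue_on {0..})"
      by (intro continuous_imp_measurable_on_sets_lebesgue continuous_intros cont) auto
    show "(\<lambda>t. M * C * exp (- 1 * t)) integrable_on {0..}"
      by (intro integrable_on_mult_right integrable_on_exp_minus_to_infinity) auto
    fix t :: real assume "t \<in> {0..}"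
    hence t: "t \<ge> 0" by simp
    have "t\<^sup>2 / 4 \<le> exp t / 2"
      using exp_lower_Taylor_quadratic[OF t] t by simp
    also have "\<dots> \<le> cosh t" by (simp add: cosh_field_def)
    finally have "a * (t\<^sup>2 / 4) \<le> a * cosh t" using a by (intro mult_left_mono) auto
    moreover have "0 \<le> ((\<sigma> + 1) - a * t / 2)\<^sup>2 / a" using a by simp
    hence "(\<sigma> + 1) * t \<le> (\<sigma> + 1)\<^sup>2 / a + a * (t\<^sup>2 / 4)"
      using a by (simp add: field_simps power2_eq_square)
    ultimately have "- a * cosh t + \<sigma> * t \<le> (\<sigma> + 1)\<^sup>2 / a - t"
      by (simp add: algebra_simps)
    hence "exp (- a * cosh t) * exp (\<sigma> * t) \<le> C * exp (- 1 * t)"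
      by (simp add: C_def flip: exp_add)
    hence 1: "M * (exp (- a * cosh t) * exp (\<sigma> * t)) \<le> M * (C * exp (- 1 * t))"
      using M by (rule mult_left_mono)
    have "norm (exp (- a * cosh t) *\<^sub>R g t) \<le> exp (- a * cosh t) * (M * exp (\<sigma> * t))"
      unfolding norm_scaleR abs_exp_cancel by (intro mult_left_mono bound t) auto
    also have "\<dots> = M * (exp (- a * cosh t) * exp (\<sigma> * t))" by (simp only: mult_ac)
    also note 1
    finally show "norm (exp (- a * cosh t) *\<^sub>R g t) \<le> M * C * exp (- 1 * t)"
      by (simp only: mult.assoc)
  qed auto
  thus ?thesis by (rule absolutely_integrable_on_def[THEN iffD1, THEN conjunct1])
qed

lemma norm_cosh_le:
  fixes s :: complex
  assumes "t \<ge> 0"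
  shows "norm (cosh (s * of_real t)) \<le> exp (norm s * t)"
proof -
  let ?z = "s * of_real t"
  have "norm (cosh ?z) \<le> (norm (exp ?z) + norm (exp (- ?z))) / 2"
    unfolding cosh_field_def norm_divide
    using norm_triangle_ineq[of "exp ?z" "exp (- ?z)"] by (simp del: norm_exp_eq_Re)
  also have "\<dots> \<le> (exp (norm ?z) + exp (norm (- ?z))) / 2"
    by (intro divide_right_mono add_mono norm_exp) auto
  finally show ?thesis using assms by (simp add: norm_mult)
qed

lemma bessel_K_integrable:
  fixes s :: complex
  assumes "x > 0"
  shows "(\<lambda>t. of_real (exp (- x * cosh t)) * cosh (s * of_real t)) integrable_on {0..}"
proof -
  have "(\<lambda>t. exp (- x * cosh t) *\<^sub>R cosh (s * of_real t)) integrable_on {0..}"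
    by (rule cosh_weight_integrable[OF assms, where M = 1 and \<sigma> = "norm s"])
       (auto intro!: continuous_intros norm_cosh_le)
  thus ?thesis by (simp add: scaleR_conv_of_real)
qed

text \<open>
  The function \<open>K\<^sub>0\<close>, real-valued so that it can serve as a yardstick in inequalities.
\<close>

definition bessel_K0 :: "real \<Rightarrow> real" where
  "bessel_K0 x = integral {0..} (\<lambda>t. exp (- x * cosh t))"

lemma bessel_K0_integrable:
  fixes x :: real
  shows "x > 0 \<Longrightarrow> (\<lambda>t. exp (- x * cosh t)) integrable_on {0..}"
  using cosh_weight_integrable[of x "\<lambda>_. 1::real" 1 0] by simp

lemma bessel_K0_ge:
  assumes "x > 0" "\<eta> \<ge> 0"
  shows "\<eta> * exp (- x * cosh \<eta>) \<le> bessel_K0 x"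
proof -
  have "\<eta> * exp (- x * cosh \<eta>) = integral {0..\<eta>} (\<lambda>t. exp (- x * cosh \<eta>))"
    using assms by simp
  also have "\<dots> \<le> integral {0..\<eta>} (\<lambda>t. exp (- x * cosh t))"
    using assms
    by (intro integral_le integrable_continuous_real continuous_intros)
       (auto simp: cosh_real_nonneg_le_iff)
  also have "\<dots> \<le> bessel_K0 x"
    unfolding bessel_K0_def using assms
    by (intro integral_subset_le bessel_K0_integrable integrable_continuous_real continuous_intros) auto
  finally show ?thesis .
qed

lemma bessel_K0_pos: "x > 0 \<Longrightarrow> bessel_K0 x > 0"
  using bessel_K0_ge[of x 1] by (smt (verit) exp_gt_zero mult_1)

text \<open>
  This is \<open>cosh t \<ge> 1\<close> under the integral.
\<close>

lemma bessel_K0_decay: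
  assumes "x > 0" "h \<ge> 0"
  shows "bessel_K0 (x + h) \<le> exp (- h) * bessel_K0 x"
proof -
  have "bessel_K0 (x + h) \<le> integral {0..} (\<lambda>t. exp (- h) * exp (- x * cosh t))"
    unfolding bessel_K0_def
  proof (intro integral_le integrable_on_mult_right bessel_K0_integrable)
    fix t :: real
    have "h * 1 \<le> h * cosh t"
      using assms(2) cosh_real_ge_1 by (intro mult_left_mono) auto
    thus "exp (- (x + h) * cosh t) \<le> exp (- h) * exp (- x * cosh t)"
      by (simp add: algebra_simps flip: exp_add)
  qed (use assms bessel_K0_integrable[of x] in auto)
  thus ?thesis by (simp add: bessel_K0_def)
qed

text \<open>
  For large \<open>x\<close> the weight \<open>exp (- x cosh t)\<close> concentrates at \<open>t = 0\<close>, where \<open>cosh (s t) = 1\<close>. On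
  \<open>[0, \<eta>]\<close> the difference \<open>cosh (s t) - 1\<close> is at most \<open>1/4\<close>; the tail beyond \<open>\<eta>\<close> is
  \<open>O(exp (- x cosh \<eta>))\<close>, which is negligible against the contribution of \<open>[0, \<eta>/2]\<close> to \<open>K\<^sub>0(x)\<close>, of
  size at least \<open>\<eta>/2 * exp (- x cosh (\<eta>/2))\<close>.
\<close>

lemma bessel_K_near_bessel_K0:
  "\<exists>x0>0. \<forall>x\<ge>x0. norm (bessel_K s x - of_real (bessel_K0 x)) \<le> bessel_K0 x / 2"
proof -
  define g where "g t = cosh (s * of_real t) - 1" for t :: real
  define \<sigma> where "\<sigma> = norm s"
  have g_cont: "continuous_on A g" for A
    unfolding g_def by (intro continuous_intros)
  have g_bound: "norm (g t) \<le> 2 * exp (\<sigma> * t)" if "t \<ge> 0" for t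
  proof -
    have "norm (g t) \<le> norm (cosh (s * of_real t)) + 1"
      unfolding g_def by (rule order_trans[OF norm_triangle_ineq4]) simp
    moreover have "1 \<le> exp (\<sigma> * t)" using that by (simp add: \<sigma>_def)
    ultimately show ?thesis using norm_cosh_le[OF that, of s] unfolding \<sigma>_def by linarith
  qed
  have "isCont g 0"
    using g_cont[of UNIV] by (simp add: continuous_on_eq_continuous_at)
  hence "\<forall>\<^sub>F t in nhds 0. dist (g t) (g 0) < 1/4"
    by (intro tendstoD) (auto simp: isCont_def tendsto_at_iff_tendsto_nhds)
  then obtain \<eta>' where "\<eta>' > 0" "\<And>t. dist t 0 < \<eta>' \<Longrightarrow> dist (g t) (g 0) < 1/4"
    unfolding eventually_nhds_metric by blast
  hence \<eta>': "\<eta>' > 0" "\<And>t. \<bar>t\<bar> < \<eta>' \<Longrightarrow> norm (g t) < 1/4"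
    by (simp_all add: g_def)
  define \<eta> where "\<eta> = \<eta>' / 2"
  have \<eta>: "\<eta> > 0" "\<And>t. 0 \<le> t \<Longrightarrow> t \<le> \<eta> \<Longrightarrow> norm (g t) \<le> 1/4"
    using \<eta>' by (auto simp: \<eta>_def intro!: less_imp_le)
  define C where "C = integral {0..} (\<lambda>t. exp (- 1 * cosh t) * (2 * exp (\<sigma> * t)))"
  have C_int: "(\<lambda>t. exp (- 1 * cosh t) * (2 * exp (\<sigma> * t))) integrable_on {0..}"
    using cosh_weight_integrable[of 1 "\<lambda>t. 2 * exp (\<sigma> * t)" 2 \<sigma>]
    by (simp add: continuous_intros)
  have C: "C \<ge> 0" unfolding C_def by (intro integral_nonneg C_int) auto
  define d where "d = cosh \<eta> - cosh (\<eta> / 2)"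
  have d: "d > 0" using \<eta>(1) by (simp add: d_def cosh_real_nonneg_less_iff)
  \<comment> \<open>chosen so that \<open>exp (x d) \<ge> 1 + x d\<close> makes the tail at most a quarter of \<open>K\<^sub>0(x)\<close>\<close>
  define x0 where "x0 = 1 + 8 * C * exp (cosh \<eta>) / (\<eta> * d)"
  have x0: "x0 \<ge> 1" using C d \<eta>(1) by (simp add: x0_def)
  have "norm (bessel_K s x - of_real (bessel_K0 x)) \<le> bessel_K0 x / 2" if x: "x \<ge> x0" for x
  proof -
    have x1: "x \<ge> 1" using x x0 by simp
    have int_g: "(\<lambda>t. exp (- x * cosh t) *\<^sub>R g t) integrable_on {0..}"
      using x1 by (intro cosh_weight_integrable[where M = 2 and \<sigma> = \<sigma>] g_cont g_bound) auto
    have diff: "bessel_K s x - of_real (bessel_K0 x) = integral {0..} (\<lambda>t. exp (- x * cosh t) *\<^sub>R g t)"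
    proof -
      have i: "((\<lambda>t. complex_of_real (exp (- x * cosh t))) has_integral of_real (bessel_K0 x)) {0..}"
        unfolding bessel_K0_def using x1
        by (intro has_integral_of_real integrable_integral bessel_K0_integrable) auto
      have "((\<lambda>t. of_real (exp (- x * cosh t)) * cosh (s * of_real t) - of_real (exp (- x * cosh t)))
              has_integral (bessel_K s x - of_real (bessel_K0 x))) {0..}"
        unfolding bessel_K_def using x1
        by (intro has_integral_diff i integrable_integral bessel_K_integrable) auto
      hence "((\<lambda>t. exp (- x * cosh t) *\<^sub>R g t)
              has_integral (bessel_K s x - of_real (bessel_K0 x))) {0..}"
        by (simp add: g_def scaleR_conv_of_real algebra_simps)
      thus ?thesis by (simp add: has_integral_iff)
    qed
    have "norm (bessel_K s x - of_real (bessel_K0 x)) \<le> integral {0..} (\<lambda>t. 1/4 * exp (- x * cosh t) +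
                   exp (- (x - 1) * cosh \<eta>) * (exp (- 1 * cosh t) * (2 * exp (\<sigma> * t))))"
      unfolding diff
    proof (rule integral_norm_bound_integral[OF int_g])
      show "(\<lambda>t. 1/4 * exp (- x * cosh t) +
              exp (- (x - 1) * cosh \<eta>) * (exp (- 1 * cosh t) * (2 * exp (\<sigma> * t)))) integrable_on {0..}"
        using x1 by (intro integrable_add integrable_on_mult_right C_int bessel_K0_integrable) auto
      fix t :: real assume "t \<in> {0..}"
      hence t: "t \<ge> 0" by simp
      show "norm (exp (- x * cosh t) *\<^sub>R g t) \<le> 1/4 * exp (- x * cosh t) +
              exp (- (x - 1) * cosh \<eta>) * (exp (- 1 * cosh t) * (2 * exp (\<sigma> * t)))"
      proof (cases "t \<le> \<eta>")
        case True
        have "norm (exp (- x * cosh t) *\<^sub>R g t) \<le> exp (- x * cosh t) * (1/4)"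
          using \<eta>(2)[OF t True] by (simp del: mult_minus_left)
        thus ?thesis by (simp add: add_increasing2)
      next
        case False
        have "(x - 1) * cosh \<eta> \<le> (x - 1) * cosh t"
          using x1 False \<eta>(1) by (intro mult_left_mono) (auto simp: cosh_real_nonneg_le_iff)
        hence "exp (- x * cosh t) \<le> exp (- (x - 1) * cosh \<eta>) * exp (- 1 * cosh t)"
          by (simp add: algebra_simps flip: exp_add)
        hence "exp (- x * cosh t) * norm (g t) \<le>
                 (exp (- (x - 1) * cosh \<eta>) * exp (- 1 * cosh t)) * (2 * exp (\<sigma> * t))"
          by (intro mult_mono g_bound t) auto
        thus ?thesis by (simp add: mult.assoc add_increasing)
      qed
    qed
    also have "\<dots> = bessel_K0 x / 4 + exp (- (x - 1) * cosh \<eta>) * C"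
    proof -
      have "((\<lambda>t. 1/4 * exp (- x * cosh t) +
              exp (- (x - 1) * cosh \<eta>) * (exp (- 1 * cosh t) * (2 * exp (\<sigma> * t))))
            has_integral (1/4 * bessel_K0 x + exp (- (x - 1) * cosh \<eta>) * C)) {0..}"
        unfolding C_def bessel_K0_def using x1
        by (intro has_integral_add has_integral_mult_right integrable_integral C_int
              bessel_K0_integrable) auto
      thus ?thesis by (simp add: has_integral_iff)
    qed
    also have "exp (- (x - 1) * cosh \<eta>) * C \<le> bessel_K0 x / 4"
    proof -
      have "8 * C * exp (cosh \<eta>) \<le> (x - 1) * (\<eta> * d)"
        using x d \<eta>(1) by (simp add: x0_def field_simps)
      also have "\<dots> \<le> (1 + x * d) * \<eta>" using d \<eta>(1) by (simp add: algebra_simps)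
      also have "\<dots> \<le> exp (x * d) * \<eta>"
        using \<eta>(1) by (intro mult_right_mono exp_ge_add_one_self) auto
      finally have "exp (- x * cosh \<eta>) * (8 * C * exp (cosh \<eta>)) \<le> exp (- x * cosh \<eta>) * (exp (x * d) * \<eta>)"
        by (rule mult_left_mono) simp
      moreover have "exp (- x * cosh \<eta>) * (8 * C * exp (cosh \<eta>)) = 8 * (exp (- (x - 1) * cosh \<eta>) * C)"
      proof -
        have "exp (- x * cosh \<eta>) * exp (cosh \<eta>) = exp (- (x - 1) * cosh \<eta>)"
          unfolding exp_add[symmetric] by (rule arg_cong[of _ _ exp]) (simp add: left_diff_distrib)
        from this[symmetric] show ?thesis by (simp only: mult_ac)
      qed
      moreover have "exp (- x * cosh \<eta>) * (exp (x * d) * \<eta>) = \<eta> * exp (- x * cosh (\<eta> / 2))"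
      proof -
        have "exp (- x * cosh \<eta>) * exp (x * d) = exp (- x * cosh (\<eta> / 2))"
          unfolding exp_add[symmetric] by (rule arg_cong[of _ _ exp]) (simp add: d_def right_diff_distrib)
        from this[symmetric] show ?thesis by (simp only: mult_ac)
      qed
      ultimately have "8 * (exp (- (x - 1) * cosh \<eta>) * C) \<le> \<eta> * exp (- x * cosh (\<eta> / 2))"
        by (simp only:)
      also have "\<dots> = 2 * (\<eta> / 2 * exp (- x * cosh (\<eta> / 2)))" by simp
      also have "\<dots> \<le> 2 * bessel_K0 x"
        using x1 \<eta>(1) by (intro mult_left_mono bessel_K0_ge) auto
      finally show ?thesis by linarith
    qed
    finally show ?thesis by simp
  qed
  thus ?thesis using x0 by (intro exI[of _ x0]) auto
qed

text \<open>
  Both properties pass from \<open>K\<^sub>0\<close> to \<open>K\<^sub>s\<close>, since the two are within constant factors of each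
  other.
\<close>

lemma bessel_K_eventually_nonzero_decay:
  "\<exists>x0>0. \<forall>x\<ge>x0. bessel_K s x \<noteq> 0 \<and>
     (\<forall>h\<ge>0. norm (bessel_K s (x + h)) \<le> 3 * exp (- h) * norm (bessel_K s x))"
proof -
  obtain x0 where x0: "x0 > 0"
    "\<And>x. x \<ge> x0 \<Longrightarrow> norm (bessel_K s x - of_real (bessel_K0 x)) \<le> bessel_K0 x / 2"
    using bessel_K_near_bessel_K0 by blast
  have lower: "bessel_K0 x \<le> 2 * norm (bessel_K s x)" and upper: "norm (bessel_K s x) \<le> 3/2 * bessel_K0 x"
    if "x \<ge> x0" for x
    using x0(2)[OF that] x0(1) that bessel_K0_pos[of x]
      norm_triangle_ineq2[of "of_real (bessel_K0 x)" "bessel_K s x"]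
      norm_triangle_ineq2[of "bessel_K s x" "of_real (bessel_K0 x)"]
    by (auto simp: norm_minus_commute)
  have "bessel_K s x \<noteq> 0 \<and>
     (\<forall>h\<ge>0. norm (bessel_K s (x + h)) \<le> 3 * exp (- h) * norm (bessel_K s x))" if x: "x \<ge> x0" for x
  proof (intro conjI allI impI)
    show "bessel_K s x \<noteq> 0" using lower[OF x] bessel_K0_pos[of x] x x0(1) by auto
    fix h :: real assume h: "h \<ge> 0"
    have "norm (bessel_K s (x + h)) \<le> 3/2 * bessel_K0 (x + h)" using x h by (intro upper) auto
    also have "\<dots> \<le> 3/2 * (exp (- h) * bessel_K0 x)"
      using x x0(1) h by (intro mult_left_mono bessel_K0_decay) auto
    also have "\<dots> \<le> 3/2 * (exp (- h) * (2 * norm (bessel_K s x)))"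
      by (intro mult_left_mono lower x) auto
    finally show "norm (bessel_K s (x + h)) \<le> 3 * exp (- h) * norm (bessel_K s x)" by simp
  qed
  thus ?thesis using x0(1) by blast
qed

text \<open>
  The derivative in \<open>x\<close> of the integrand is dominated on \<open>[a, \<infinity>)\<close> by a fixed integrable function of
  \<open>t\<close>, using \<open>cosh t \<le> exp t\<close>.
\<close>

lemma bessel_K_lipschitz:
  assumes a: "a > 0"
  shows "\<exists>L\<ge>0. \<forall>x\<ge>a. \<forall>y\<ge>a. norm (bessel_K s x - bessel_K s y) \<le> L * \<bar>x - y\<bar>"
proof -
  define \<sigma> where "\<sigma> = norm s + 1"
  define L where "L = integral {0..} (\<lambda>t. exp (- a * cosh t) * exp (\<sigma> * t))"
  have L_int: "(\<lambda>t. exp (- a * cosh t) * exp (\<sigma> * t)) integrable_on {0..}"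
    using cosh_weight_integrable[OF a, of "\<lambda>t. exp (\<sigma> * t)" 1 \<sigma>] by (simp add: continuous_intros)
  have L: "L \<ge> 0" unfolding L_def by (intro integral_nonneg L_int) auto
  have exp_diff: "\<bar>exp (- x * c) - exp (- y * c)\<bar> \<le> \<bar>x - y\<bar> * (c * exp (- a * c))"
    if "c \<ge> 0" "x \<ge> a" "y \<ge> a" for x y c :: real
    using that
  proof (induction x y rule: linorder_wlog)
    case (le x y)
    have "exp (- x * c) - exp (- y * c) = exp (- x * c) * (1 - exp (- ((y - x) * c)))"
      by (simp add: algebra_simps flip: exp_add)
    also have "\<dots> \<le> exp (- x * c) * ((y - x) * c)"
      using exp_ge_add_one_self[of "- ((y - x) * c)"] by (intro mult_left_mono) auto
    also have "\<dots> \<le> exp (- a * c) * ((y - x) * c)"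
      using le by (intro mult_right_mono) (auto intro: mult_right_mono)
    finally show ?case using le by (simp add: mult_ac mult_left_mono)
  next
    case (sym x y) thus ?case by (simp add: abs_minus_commute)
  qed
  have "norm (bessel_K s x - bessel_K s y) \<le> L * \<bar>x - y\<bar>" if xy: "x \<ge> a" "y \<ge> a" for x y
  proof -
    let ?f = "\<lambda>x t. of_real (exp (- x * cosh t)) * cosh (s * of_real t)"
    have ints: "?f x integrable_on {0..}" "?f y integrable_on {0..}"
      using xy a by (auto intro!: bessel_K_integrable[simplified])
    have "bessel_K s x - bessel_K s y = integral {0..} (\<lambda>t. ?f x t - ?f y t)"
      unfolding bessel_K_def by (rule integral_diff[symmetric]) (fact ints)+
    also have "norm \<dots> \<le> integral {0..} (\<lambda>t. \<bar>x - y\<bar> * (exp (- a * cosh t) * exp (\<sigma> * t)))"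
    proof (rule integral_norm_bound_integral)
      show "(\<lambda>t. ?f x t - ?f y t) integrable_on {0..}" by (rule integrable_diff) (fact ints)+
      show "(\<lambda>t. \<bar>x - y\<bar> * (exp (- a * cosh t) * exp (\<sigma> * t))) integrable_on {0..}"
        by (intro integrable_on_mult_right L_int)
      fix t :: real assume "t \<in> {0..}"
      hence t: "t \<ge> 0" by simp
      have "cosh t \<le> exp t" using t by (simp add: cosh_field_def)
      have "norm (?f x t - ?f y t) = \<bar>exp (- x * cosh t) - exp (- y * cosh t)\<bar> * norm (cosh (s * of_real t))"
        by (simp only: left_diff_distrib[symmetric] norm_mult of_real_diff[symmetric] norm_of_real)
      also have "\<dots> \<le> (\<bar>x - y\<bar> * (cosh t * exp (- a * cosh t))) * exp (norm s * t)"
        using xy by (intro mult_mono exp_diff norm_cosh_le t) auto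
      also have "\<dots> \<le> (\<bar>x - y\<bar> * (exp t * exp (- a * cosh t))) * exp (norm s * t)"
        using \<open>cosh t \<le> exp t\<close> by (intro mult_left_mono mult_right_mono) auto
      also have "\<dots> = \<bar>x - y\<bar> * (exp (- a * cosh t) * exp (\<sigma> * t))"
        by (simp add: \<sigma>_def algebra_simps exp_add)
      finally show "norm (?f x t - ?f y t) \<le> \<bar>x - y\<bar> * (exp (- a * cosh t) * exp (\<sigma> * t))" .
    qed
    also have "\<dots> = L * \<bar>x - y\<bar>" by (simp add: L_def)
    finally show ?thesis .
  qed
  thus ?thesis using L by blast
qed

section \<open>Interval sums for holomorphic cusp forms\<close>

text \<open>
  The tangent of the logarithm at \<open>c = \<bar>p\<bar> + 1\<close> gives \<open>\<bar>p\<bar> ln y \<le> \<bar>p\<bar> ln c + y\<close>.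
\<close>

lemma powr_le_const_mult_exp:
  fixes p y :: real
  assumes "y \<ge> 1"
  shows "y powr p \<le> (\<bar>p\<bar> + 1) powr \<bar>p\<bar> * exp y"
proof -
  define c where "c = \<bar>p\<bar> + 1"
  have c: "c > 0" "c \<ge> \<bar>p\<bar>" by (auto simp: c_def)
  have "ln (y / c) \<le> y / c" using ln_le_minus_one[of "y / c"] assms c by simp
  hence "ln y \<le> ln c + y / c" using assms c by (simp add: ln_div)
  hence "\<bar>p\<bar> * ln y \<le> \<bar>p\<bar> * (ln c + y / c)" by (rule mult_left_mono) simp
  also have "\<dots> = \<bar>p\<bar> * ln c + y * (\<bar>p\<bar> / c)" by (simp add: algebra_simps)
  also have "y * (\<bar>p\<bar> / c) \<le> y * 1"
    using c assms by (intro mult_left_mono) auto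
  finally have "\<bar>p\<bar> * ln y \<le> \<bar>p\<bar> * ln c + y" by simp
  moreover have "p * ln y \<le> \<bar>p\<bar> * ln y"
    using assms by (intro mult_right_mono) auto
  ultimately have "exp (p * ln y) \<le> exp (\<bar>p\<bar> * ln c + y)" by simp
  thus ?thesis using assms c by (simp add: powr_def exp_add c_def)
qed

lemma e_fun_of_int_real: "e_fun (of_int n * of_real x) = cis (2 * pi * of_int n * x)"
  by (simp add: e_fun_def cis_conv_exp mult_ac)

lemma e_fun_of_int_mult:
  "e_fun (of_int n * z) = of_real (exp (- 2 * pi * of_int n * Im z)) * cis (2 * pi * of_int n * Re z)"
proof -
  have "2 * of_real pi * \<i> * (of_int n * z) =
          of_real (- 2 * pi * of_int n * Im z) + \<i> * of_real (2 * pi * of_int n * Re z)"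
    by (subst complex_eq[of z]) (simp add: algebra_simps)
  thus ?thesis by (simp only: e_fun_def exp_add exp_of_real cis_conv_exp)
qed

text \<open>
  At height at least \<open>1\<close>, each term of the Fourier series is at most \<open>exp (1 - Im z)\<close> times the
  corresponding term at \<open>\<i>\<close>; this exponential outweighs \<open>Im z powr (\<kappa>/2)\<close>.
\<close>

lemma holomorphic_scaled_bounded:
  assumes f: "holomorphic_cusp_form \<kappa> f" and A: "holomorphic_fourier_coeffs \<kappa> f A"
  shows "\<exists>B\<ge>0. \<forall>z. Im z > 0 \<longrightarrow> Im z powr (of_int \<kappa> / 2) * norm (f z) \<le> B"
proof -
  define a where "a n = A n * of_real (real_of_int n powr ((real_of_int \<kappa> - 1) / 2))" for n
  have series: "((\<lambda>n. a n * e_fun (of_int n * z)) has_sum f z) {1..}" if "Im z > 0" for z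
    using A that unfolding holomorphic_fourier_coeffs_def upper_half_plane_def a_def by auto
  have "(\<lambda>n. norm (a n * e_fun (of_int n * \<i>))) summable_on {1..}"
    using has_sum_imp_summable[OF series[of \<i>]] by (simp add: summable_on_iff_abs_summable_on_complex)
  then obtain T where T: "((\<lambda>n. norm (a n * e_fun (of_int n * \<i>))) has_sum T) {1..}"
    using summable_on_def by blast
  have T0: "T \<ge> 0" using T by (rule has_sum_nonneg) auto
  define p where "p = of_int \<kappa> / (2::real)"
  define M where "M = (\<bar>p\<bar> + 1) powr \<bar>p\<bar>"
  have "Im z powr p * norm (f z) \<le> M * exp 1 * T" if z: "Im z \<ge> 1" for z
  proof -
    have "norm (f z) \<le> exp (1 - Im z) * T"
    proof (rule norm_infsum_le)
      show "((\<lambda>n. a n * e_fun (of_int n * z)) has_sum f z) {1..}" using z by (intro series) auto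
      show "((\<lambda>n. exp (1 - Im z) * norm (a n * e_fun (of_int n * \<i>))) has_sum exp (1 - Im z) * T) {1..}"
        by (intro has_sum_cmult_right T)
      fix n :: int assume "n \<in> {1..}"
      hence n: "real_of_int n \<ge> 1" by simp
      have "1 * (Im z - 1) \<le> (2 * pi * of_int n) * (Im z - 1)"
        using n pi_gt3 z mult_mono[of 1 "2 * pi" 1 "real_of_int n"]
        by (intro mult_right_mono) auto
      hence "exp (- 2 * pi * of_int n * Im z) \<le> exp (1 - Im z) * exp (- 2 * pi * of_int n * 1)"
        unfolding exp_add[symmetric] exp_le_cancel_iff by (simp add: algebra_simps)
      hence "norm (a n) * exp (- 2 * pi * of_int n * Im z) \<le>
               norm (a n) * (exp (1 - Im z) * exp (- 2 * pi * of_int n * 1))"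
        by (rule mult_left_mono) simp
      thus "norm (a n * e_fun (of_int n * z)) \<le> exp (1 - Im z) * norm (a n * e_fun (of_int n * \<i>))"
        unfolding e_fun_of_int_mult by (simp add: norm_mult mult_ac)
    qed
    hence "Im z powr p * norm (f z) \<le> (M * exp (Im z)) * (exp (1 - Im z) * T)"
      unfolding M_def by (intro mult_mono powr_le_const_mult_exp z) auto
    also have "\<dots> = M * (exp (Im z) * exp (1 - Im z)) * T" by (simp only: mult_ac)
    also have "exp (Im z) * exp (1 - Im z) = exp 1" by (simp flip: exp_add)
    finally show ?thesis .
  qed
  thus ?thesis
    using f unfolding p_def holomorphic_cusp_form_def
    by (intro modular_form_scaled_bounded[where Y = 1])
       (auto intro: holomorphic_on_imp_continuous_on)
qed

lemma lipschitz_on_Icc_of_deriv: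
  fixes g g' :: "real \<Rightarrow> real"
  assumes deriv: "\<And>t. t \<in> {a..b} \<Longrightarrow> (g has_real_derivative g' t) (at t within {a..b})"
    and cont: "continuous_on {a..b} g'"
  shows "\<exists>L. L-lipschitz_on {a..b} (\<lambda>t. complex_of_real (g t))"
proof -
  have "bounded (g' ` {a..b})"
    by (intro compact_imp_bounded compact_continuous_image cont) auto
  then obtain L where L: "L > 0" "\<And>t. t \<in> {a..b} \<Longrightarrow> norm (g' t) \<le> L"
    unfolding bounded_pos by blast
  have "norm (g x - g y) \<le> L * norm (x - y)" if "x \<in> {a..b}" "y \<in> {a..b}" for x y
    by (rule field_differentiable_bound[OF convex_real_interval(5) deriv]) (use L that in auto)
  thus ?thesis
    using L(1) by (intro exI[of _ L] lipschitz_onI) (auto simp: dist_norm simp flip: of_real_diff)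
qed

text \<open>
  Wilton's bound at height \<open>1/X\<close>. The Fourier coefficients of \<open>f\<close> on this line are \<open>X powr q\<close> times
  \<open>A n * g (n/X)\<close> with \<open>q = (\<kappa> - 1)/2\<close>, while \<open>f\<close> is \<open>O(X powr (\<kappa>/2))\<close> there; the quotient of the
  two powers is \<open>sqrt X\<close>.
\<close>

lemma holomorphic_interval_sums:
  assumes f: "holomorphic_cusp_form \<kappa> f" and A: "holomorphic_fourier_coeffs \<kappa> f A"
  shows "\<exists>K\<ge>0. \<forall>X\<ge>1. \<forall>a b. 2 * X \<le> of_int a \<longrightarrow> of_int b \<le> 4 * X \<longrightarrow> of_int (b - a) \<le> X \<longrightarrow>
           norm (\<Sum>n=a..b. A n) \<le> K * sqrt X * ln (2 + X)"
proof -
  define q where "q = (real_of_int \<kappa> - 1) / 2"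
  define g where "g t = t powr q * exp (- 2 * pi * t)" for t :: real
  obtain B where B: "B \<ge> 0" "\<And>z. Im z > 0 \<Longrightarrow> Im z powr (of_int \<kappa> / 2) * norm (f z) \<le> B"
    using holomorphic_scaled_bounded[OF f A] by blast
  have "\<exists>L. L-lipschitz_on {2..4} (\<lambda>t. complex_of_real (g t))"
  proof (rule lipschitz_on_Icc_of_deriv)
    fix t :: real assume "t \<in> {2..4}"
    thus "(g has_real_derivative (q * t powr (q - 1) * exp (- 2 * pi * t) +
            t powr q * (exp (- 2 * pi * t) * (- 2 * pi)))) (at t within {2..4})"
      unfolding g_def by (auto intro!: derivative_eq_intros)
  qed (auto intro!: continuous_intros)
  then obtain L where L: "L-lipschitz_on {2..4} (\<lambda>t. complex_of_real (g t))" by blast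
  show ?thesis
  proof (rule remove_weight[OF L])
    show "complex_of_real (g t) \<noteq> 0" if "t \<in> {2..4}" for t
      using that by (simp add: g_def)
    fix X :: real and a b :: int assume X: "X \<ge> 1" and a: "a \<ge> 1"
    define c where "c n = of_real (X powr q) * (A n * of_real (g (n / X)))" for n :: int
    define z where "z x = Complex x (1 / X)" for x
    have z: "Im (z x) = 1 / X" "Re (z x) = x" "Im (z x) > 0" for x using X by (auto simp: z_def)
    have "norm (\<Sum>n=a..b. c n) \<le> 4 * (B * X powr (of_int \<kappa> / 2)) * ln (2 + real_of_int \<bar>b - a\<bar>)"
    proof (rule norm_sum_fourier_coeffs_le)
      fix x :: real
      have "((\<lambda>n. A n * of_real (real_of_int n powr q) * e_fun (of_int n * z x)) has_sum f (z x)) {1..}"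
        using A z(3) unfolding holomorphic_fourier_coeffs_def upper_half_plane_def q_def by auto
      thus "((\<lambda>n. c n * cis (2 * pi * n * x)) has_sum f (z x)) {1..}"
      proof (rule has_sum_cong[THEN iffD1, rotated])
        fix n :: int assume "n \<in> {1..}"
        hence n: "real_of_int n \<ge> 1" by simp
        have "X powr q * (n / X) powr q = n powr q"
          using n X by (simp add: powr_divide)
        hence "X powr q * g (n / X) = n powr q * exp (- 2 * pi * n / X)"
          by (simp add: g_def flip: mult.assoc)
        hence "c n = A n * of_real (n powr q * exp (- 2 * pi * n / X))"
          unfolding c_def by (metis mult.left_commute of_real_mult)
        thus "A n * of_real (real_of_int n powr q) * e_fun (of_int n * z x) = c n * cis (2 * pi * n * x)"
          unfolding e_fun_of_int_mult z by simp
      qed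
      have "(1 / X) powr (of_int \<kappa> / 2) * norm (f (z x)) \<le> B"
        using B(2)[OF z(3)] z(1) by simp
      thus "norm (f (z x)) \<le> B * X powr (of_int \<kappa> / 2)"
        using X by (simp add: powr_divide field_simps)
    qed (use a in auto)
    also have "(\<Sum>n=a..b. c n) = of_real (X powr q) * (\<Sum>n=a..b. A n * of_real (g (n / X)))"
      by (simp add: c_def sum_distrib_left)
    also have "X powr (of_int \<kappa> / 2) = X powr q * sqrt X"
      using X by (simp add: q_def powr_half_sqrt[symmetric] powr_add[symmetric] field_simps)
    finally have "X powr q * norm (\<Sum>n=a..b. A n * of_real (g (n / X))) \<le>
        X powr q * (4 * B * sqrt X * ln (2 + real_of_int \<bar>b - a\<bar>))"
      by (simp add: norm_mult mult_ac)
    moreover have "X powr q > 0" using X by simp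
    ultimately show "norm (\<Sum>n=a..b. A n * of_real (g (n / X))) \<le>
        4 * B * sqrt X * ln (2 + real_of_int \<bar>b - a\<bar>)"
      by (simp only: mult_le_cancel_left_pos)
  qed
qed

section \<open>Interval sums for Maass cusp forms\<close>

text \<open>
  Above the height \<open>Y\<close> all Bessel factors have arguments in the range where they decay, so each
  term of the Fourier series is dominated by a constant multiple of the same term at height \<open>Y\<close>,
  and the latter form an absolutely convergent series.
\<close>

lemma maass_bounded:
  assumes f: "maass_cusp_form \<nu> f" and A: "maass_fourier_coeffs \<nu> f A"
  shows "\<exists>B\<ge>0. \<forall>z. Im z > 0 \<longrightarrow> norm (f z) \<le> B"
proof -
  obtain x0 where x0: "x0 > 0" "\<And>x. x \<ge> x0 \<Longrightarrow> bessel_K (\<i> * \<nu>) x \<noteq> 0 \<and>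
     (\<forall>h\<ge>0. norm (bessel_K (\<i> * \<nu>) (x + h)) \<le> 3 * exp (- h) * norm (bessel_K (\<i> * \<nu>) x))"
    using bessel_K_eventually_nonzero_decay by blast
  define Y where "Y = max 1 x0"
  have Y: "Y \<ge> 1" "Y \<ge> x0" by (auto simp: Y_def)
  define K where "K n y = bessel_K (\<i> * \<nu>) (2 * pi * \<bar>real_of_int n\<bar> * y)" for n :: int and y :: real
  have series: "((\<lambda>n. of_real (2 * sqrt (Im z)) * (A n * K n (Im z) * e_fun (of_int n * of_real (Re z))))
           has_sum f z) {n. n \<noteq> 0}" if "Im z > 0" for z
    using A that unfolding maass_fourier_coeffs_def upper_half_plane_def K_def by auto
  have norm_e: "norm (e_fun (of_int n * of_real x)) = 1" for n x
    by (simp add: e_fun_of_int_real)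
  define z0 where "z0 = Complex 0 Y"
  have "(\<lambda>n. norm (of_real (2 * sqrt (Im z0)) * (A n * K n (Im z0) * e_fun (of_int n * of_real (Re z0)))))
          summable_on {n. n \<noteq> 0}"
    using has_sum_imp_summable[OF series[of z0]] Y
    by (simp only: summable_on_iff_abs_summable_on_complex) (simp add: z0_def)
  then obtain T where T: "((\<lambda>n. norm (of_real (2 * sqrt (Im z0)) *
      (A n * K n (Im z0) * e_fun (of_int n * of_real (Re z0))))) has_sum T) {n. n \<noteq> 0}"
    using summable_on_def by blast
  have cusp: "norm (f z) \<le> 3 * exp Y * T" if z: "Im z \<ge> Y" for z
  proof (rule norm_infsum_le)
    show "((\<lambda>n. of_real (2 * sqrt (Im z)) * (A n * K n (Im z) * e_fun (of_int n * of_real (Re z))))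
           has_sum f z) {n. n \<noteq> 0}" using z Y by (intro series) auto
    show "((\<lambda>n. 3 * exp Y * norm (of_real (2 * sqrt (Im z0)) *
      (A n * K n (Im z0) * e_fun (of_int n * of_real (Re z0))))) has_sum (3 * exp Y * T)) {n. n \<noteq> 0}"
      by (intro has_sum_cmult_right T)
    fix n :: int assume "n \<in> {n. n \<noteq> 0}"
    hence n: "\<bar>real_of_int n\<bar> \<ge> 1" by (simp add: Ints_nonzero_abs_ge1)
    have c: "1 \<le> 2 * pi * \<bar>real_of_int n\<bar>"
      using n pi_gt3 mult_mono[of 1 "2 * pi" 1 "\<bar>real_of_int n\<bar>"] by auto
    define h where "h = 2 * pi * \<bar>real_of_int n\<bar> * (Im z - Y)"
    have h: "h \<ge> Im z - Y" "h \<ge> 0"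
      using z mult_right_mono[OF c, of "Im z - Y"] by (auto simp: h_def)
    have "1 * Y \<le> 2 * pi * \<bar>real_of_int n\<bar> * Y"
      using Y by (intro mult_right_mono c) auto
    hence "x0 \<le> 2 * pi * \<bar>real_of_int n\<bar> * Y"
      using Y by linarith
    moreover have "2 * pi * \<bar>real_of_int n\<bar> * Im z = 2 * pi * \<bar>real_of_int n\<bar> * Y + h"
      by (simp add: h_def algebra_simps)
    ultimately have "norm (K n (Im z)) \<le> 3 * exp (- h) * norm (K n Y)"
      unfolding K_def using x0(2) h(2) by metis
    also have "\<dots> \<le> 3 * exp (Y - Im z) * norm (K n Y)"
      using h(1) by (intro mult_right_mono) auto
    finally have K: "norm (K n (Im z)) \<le> 3 * exp (Y - Im z) * norm (K n Y)" .
    have "sqrt (Im z) \<le> Im z * sqrt Y"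
    proof -
      have "sqrt (Im z) \<le> Im z * 1"
        using Y z by (intro real_le_lsqrt) (auto simp: power2_eq_square)
      also have "\<dots> \<le> Im z * sqrt Y" using Y z by (intro mult_left_mono) auto
      finally show ?thesis .
    qed
    also have "\<dots> \<le> exp (Im z) * sqrt Y"
      using Y exp_ge_add_one_self[of "Im z"] by (intro mult_right_mono) (linarith, simp)
    finally have "sqrt (Im z) * norm (K n (Im z)) \<le>
        (exp (Im z) * sqrt Y) * (3 * exp (Y - Im z) * norm (K n Y))"
      using K Y by (intro mult_mono) auto
    also have "\<dots> = 3 * (exp (Im z) * exp (Y - Im z)) * (sqrt Y * norm (K n Y))"
      by (simp only: mult_ac)
    also have "exp (Im z) * exp (Y - Im z) = exp Y" by (simp flip: exp_add)
    finally have "2 * norm (A n) * (sqrt (Im z) * norm (K n (Im z))) \<le>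
        2 * norm (A n) * (3 * exp Y * (sqrt Y * norm (K n Y)))"
      by (rule mult_left_mono) simp
    thus "norm (of_real (2 * sqrt (Im z)) * (A n * K n (Im z) * e_fun (of_int n * of_real (Re z)))) \<le>
      3 * exp Y * norm (of_real (2 * sqrt (Im z0)) * (A n * K n (Im z0) * e_fun (of_int n * of_real (Re z0))))"
      using z Y norm_e[of n 0] by (simp add: norm_mult norm_e z0_def mult_ac)
  qed
  have "\<exists>B\<ge>0. \<forall>z. Im z > 0 \<longrightarrow> Im z powr (of_int 0 / 2) * norm (f z) \<le> B"
  proof (rule modular_form_scaled_bounded)
    show "modular_of_weight 0 f" using f by (simp add: maass_cusp_form_def)
    have "Ck_on_uhp 0 f" using f unfolding maass_cusp_form_def smooth_on_uhp_def by blast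
    thus "continuous_on upper_half_plane f" by simp
    show "Im z powr (of_int 0 / 2) * norm (f z) \<le> 3 * exp Y * T" if "Im z \<ge> Y" for z
      using cusp[OF that] that Y by auto
  qed
  thus ?thesis by auto
qed

text \<open>
  Wilton's bound at height \<open>x0/X\<close>, where \<open>x0\<close> is so large that the Bessel weight has no zero on
  the relevant range. The factor \<open>sqrt (Im z)\<close> in the Fourier expansion produces \<open>sqrt X\<close>.
\<close>

lemma maass_interval_sums:
  assumes f: "maass_cusp_form \<nu> f" and A: "maass_fourier_coeffs \<nu> f A"
  shows "\<exists>K\<ge>0. \<forall>X\<ge>1. \<forall>a b. 2 * X \<le> of_int a \<longrightarrow> of_int b \<le> 4 * X \<longrightarrow> of_int (b - a) \<le> X \<longrightarrow>
           norm (\<Sum>n=a..b. A n) \<le> K * sqrt X * ln (2 + X)"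
proof -
  obtain B where B: "B \<ge> 0" "\<And>z. Im z > 0 \<Longrightarrow> norm (f z) \<le> B"
    using maass_bounded[OF f A] by blast
  obtain x0 where x0: "x0 > 0" "\<And>x. x \<ge> x0 \<Longrightarrow> bessel_K (\<i> * \<nu>) x \<noteq> 0"
    using bessel_K_eventually_nonzero_decay by blast
  obtain L where L: "L \<ge> 0"
    "\<And>x y. x \<ge> x0 \<Longrightarrow> y \<ge> x0 \<Longrightarrow> norm (bessel_K (\<i> * \<nu>) x - bessel_K (\<i> * \<nu>) y) \<le> L * \<bar>x - y\<bar>"
    using bessel_K_lipschitz[OF x0(1)] by blast
  define \<phi> where "\<phi> t = bessel_K (\<i> * \<nu>) (2 * pi * x0 * t)" for t
  have arg: "2 * pi * x0 * t \<ge> x0" if "t \<in> {2..4}" for t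
  proof -
    have "1 \<le> 2 * pi * t" using that pi_gt3 mult_mono[of 1 "2 * pi" 1 t] by auto
    thus ?thesis using x0(1) mult_right_mono[of 1 "2 * pi * t" x0] by (simp add: mult_ac)
  qed
  have "(L * (2 * pi * x0))-lipschitz_on {2..4} \<phi>"
  proof (rule lipschitz_onI)
    fix s t :: real assume st: "s \<in> {2..4}" "t \<in> {2..4}"
    have "norm (\<phi> s - \<phi> t) \<le> L * \<bar>2 * pi * x0 * s - 2 * pi * x0 * t\<bar>"
      unfolding \<phi>_def by (intro L arg st)
    also have "\<bar>2 * pi * x0 * s - 2 * pi * x0 * t\<bar> = 2 * pi * x0 * \<bar>s - t\<bar>"
      using x0(1) by (simp add: abs_mult flip: right_diff_distrib)
    finally show "dist (\<phi> s) (\<phi> t) \<le> L * (2 * pi * x0) * dist s t"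
      by (simp add: dist_norm mult_ac)
  qed (use L x0 in auto)
  thus ?thesis
  proof (rule remove_weight)
    show "\<phi> t \<noteq> 0" if "t \<in> {2..4}" for t
      unfolding \<phi>_def by (intro x0(2) arg that)
    fix X :: real and a b :: int assume X: "X \<ge> 1" and a: "a \<ge> 1"
    define r where "r = 2 * sqrt (x0 / X)"
    have r: "r > 0" using x0 X by (simp add: r_def)
    define z where "z x = Complex x (x0 / X)" for x
    have z: "Im (z x) = x0 / X" "Re (z x) = x" "Im (z x) > 0" for x using X x0 by (auto simp: z_def)
    define c where "c n = of_real r * (A n * bessel_K (\<i> * \<nu>) (2 * pi * \<bar>real_of_int n\<bar> * (x0 / X)))"
      for n :: int
    have "norm (\<Sum>n=a..b. c n) \<le> 4 * B * ln (2 + real_of_int \<bar>b - a\<bar>)"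
    proof (rule norm_sum_fourier_coeffs_le)
      fix x :: real
      have "((\<lambda>n. of_real (2 * sqrt (Im (z x))) *
              (A n * bessel_K (\<i> * \<nu>) (2 * pi * \<bar>real_of_int n\<bar> * Im (z x)) *
               e_fun (of_int n * of_real (Re (z x))))) has_sum f (z x)) {n. n \<noteq> 0}"
        using A z(3) unfolding maass_fourier_coeffs_def upper_half_plane_def by blast
      thus "((\<lambda>n. c n * cis (2 * pi * n * x)) has_sum f (z x)) {n. n \<noteq> 0}"
        unfolding e_fun_of_int_real z c_def r_def by (simp only: mult.assoc)
      show "norm (f (z x)) \<le> B" by (intro B z)
    qed (use a in auto)
    also have "(\<Sum>n=a..b. c n) = of_real r * (\<Sum>n=a..b. A n * \<phi> (n / X))"
      unfolding sum_distrib_left c_def \<phi>_def using a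
      by (intro sum.cong refl) (simp add: mult_ac)
    finally have "r * norm (\<Sum>n=a..b. A n * \<phi> (n / X)) \<le> 4 * B * ln (2 + real_of_int \<bar>b - a\<bar>)"
      using r by (simp add: norm_mult)
    hence "norm (\<Sum>n=a..b. A n * \<phi> (n / X)) \<le> 4 * B * ln (2 + real_of_int \<bar>b - a\<bar>) / r"
      using r by (simp add: field_simps)
    also have "\<dots> = 2 * B / sqrt x0 * sqrt X * ln (2 + real_of_int \<bar>b - a\<bar>)"
      using X x0 by (simp add: r_def real_sqrt_divide field_simps)
    finally show "norm (\<Sum>n=a..b. A n * \<phi> (n / X)) \<le>
        2 * B / sqrt x0 * sqrt X * ln (2 + real_of_int \<bar>b - a\<bar>)" .
  qed
qed

section \<open>The double sum\<close>

lemma ln_le_powr_quarter: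
  fixes X :: real
  assumes "X \<ge> 1"
  shows "ln (2 + X) \<le> 12 * X powr (1/4)"
proof -
  have "ln (2 + X) \<le> (2 + X) powr (1/4) / (1/4)"
    using assms by (intro ln_powr_bound) auto
  also have "(2 + X) powr (1/4) \<le> (3 * X) powr (1/4)"
    using assms by (intro powr_mono2) auto
  also have "\<dots> = 3 powr (1/4) * X powr (1/4)"
    using assms by (simp add: powr_mult)
  also have "3 powr (1/4) \<le> (3 powr 1 :: real)" by (rule powr_mono) auto
  finally show ?thesis using assms by (simp add: divide_right_mono mult_right_mono)
qed

theorem corollary1p4:
  fixes f :: "complex \<Rightarrow> complex" and A :: "int \<Rightarrow> complex"
    and k l :: nat and \<delta>\<^sub>1 :: real
  assumes "primitive_hecke_form f A"
    and "k \<ge> 2"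
    and "\<delta>\<^sub>1 \<ge> 1 / 2"
    and "l = (LEAST j. j \<ge> 1 \<and> (2::real) ^ (j + 1) > max (real k * (1 - \<delta>\<^sub>1)) (real k * ln (real k)))"
  shows "\<forall>\<epsilon>>0. \<exists>C::real. \<forall>X\<ge>1::real.
    norm (\<Sum>n = \<lceil>X\<rceil>..\<lfloor>2 * X\<rfloor>. \<Sum>m = \<lceil>X powr (1 / real k)\<rceil>..\<lfloor>(2 * X) powr (1 / real k)\<rfloor>. A (n + m ^ k))
      \<le> C * X powr (1 + 1 / real k - (1 / (4 * real k) + 1 / 2 ^ (l + 4)) + \<epsilon>)"
proof (intro allI impI)
  fix \<epsilon> :: real assume \<epsilon>: "\<epsilon> > 0"
  have "\<exists>K\<ge>0. \<forall>X\<ge>1. \<forall>a b. 2 * X \<le> of_int a \<longrightarrow> of_int b \<le> 4 * X \<longrightarrow> of_int (b - a) \<le> X \<longrightarrow>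
           norm (\<Sum>n=a..b. A n) \<le> K * sqrt X * ln (2 + X)"
    using assms(1) holomorphic_interval_sums maass_interval_sums
    unfolding primitive_hecke_form_def holomorphic_hecke_cusp_form_def hecke_maass_cusp_form_def
    by blast
  then obtain K where K: "K \<ge> 0" "\<And>X a b. X \<ge> 1 \<Longrightarrow> 2 * X \<le> of_int a \<Longrightarrow> of_int b \<le> 4 * X \<Longrightarrow>
      of_int (b - a) \<le> X \<Longrightarrow> norm (\<Sum>n=a..b. A n) \<le> K * sqrt X * ln (2 + X)"
    by blast
  \<comment> \<open>powers of 2 are unbounded, so the minimum exists and inherits the condition \<open>j \<ge> 1\<close>\<close>
  have "l \<ge> 1"
  proof -
    define M where "M = max (real k * (1 - \<delta>\<^sub>1)) (real k * ln (real k))"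
    obtain j where "M < 2 ^ j" using real_arch_pow[of 2 M] by auto
    also have "(2::real) ^ j \<le> 2 ^ (Suc j + 1)" by simp
    finally show ?thesis
      using LeastI[of "\<lambda>j. j \<ge> 1 \<and> (2::real) ^ (j + 1) > M" "Suc j"] assms(4)
      by (simp add: M_def)
  qed
  have saving: "1 / (4 * real k) + 1 / 2 ^ (l + 4) \<le> 1 / 4"
  proof -
    have "(2::real) ^ (1 + 4) \<le> 2 ^ (l + 4)" using \<open>l \<ge> 1\<close> by (intro power_increasing) auto
    hence "1 / 2 ^ (l + 4) \<le> (1 / 2 ^ (1 + 4) :: real)" by (intro divide_left_mono) auto
    also have "\<dots> \<le> 1 / 8" by simp
    finally have "1 / 2 ^ (l + 4) \<le> (1 / 8 :: real)" .
    moreover have "1 / (4 * real k) \<le> 1 / (4 * 2)"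
      using assms(2) by (intro divide_left_mono) auto
    ultimately show ?thesis by linarith
  qed
  show "\<exists>C::real. \<forall>X\<ge>1::real.
    norm (\<Sum>n = \<lceil>X\<rceil>..\<lfloor>2 * X\<rfloor>. \<Sum>m = \<lceil>X powr (1 / real k)\<rceil>..\<lfloor>(2 * X) powr (1 / real k)\<rfloor>. A (n + m ^ k))
      \<le> C * X powr (1 + 1 / real k - (1 / (4 * real k) + 1 / 2 ^ (l + 4)) + \<epsilon>)"
  proof (intro exI allI impI)
    fix X :: real assume X: "X \<ge> 1"
    define p where "p = 1 / real k"
    have p: "p > 0" "p \<le> 1" using assms(2) by (auto simp: p_def)
    have root: "(x powr p) ^ k = x" if "x > 0" for x :: real
      using that assms(2) by (simp add: p_def powr_powr flip: powr_realpow)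
    have inner: "norm (\<Sum>n=\<lceil>X\<rceil>..\<lfloor>2 * X\<rfloor>. A (n + m ^ k)) \<le> K * sqrt X * ln (2 + X)"
      if m: "m \<in> {\<lceil>X powr p\<rceil>..\<lfloor>(2 * X) powr p\<rfloor>}" for m
    proof -
      have m': "X powr p \<le> of_int m" "of_int m \<le> (2 * X) powr p"
        using m by (auto simp: ceiling_le_iff le_floor_iff)
      have "(X powr p) ^ k \<le> of_int m ^ k" by (rule power_mono) (use m' in auto)
      hence lo: "X \<le> of_int (m ^ k)" using root[of X] X by simp
      have "of_int m ^ k \<le> ((2 * X) powr p) ^ k"
        using m' order_trans[OF powr_ge_zero m'(1)] by (intro power_mono) auto
      hence hi: "of_int (m ^ k) \<le> 2 * X" using root[of "2 * X"] X by simp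
      have "(\<Sum>n=\<lceil>X\<rceil>..\<lfloor>2 * X\<rfloor>. A (n + m ^ k)) = (\<Sum>n=\<lceil>X\<rceil> + m ^ k..\<lfloor>2 * X\<rfloor> + m ^ k. A n)"
        by (rule sum.reindex_bij_witness[where i = "\<lambda>n. n - m ^ k" and j = "\<lambda>n. n + m ^ k"]) auto
      also have "norm \<dots> \<le> K * sqrt X * ln (2 + X)"
      proof (rule K(2)[OF X])
        show "2 * X \<le> of_int (\<lceil>X\<rceil> + m ^ k)" using lo unfolding of_int_add by linarith
        show "of_int (\<lfloor>2 * X\<rfloor> + m ^ k) \<le> 4 * X" using hi unfolding of_int_add by linarith
        show "of_int (\<lfloor>2 * X\<rfloor> + m ^ k - (\<lceil>X\<rceil> + m ^ k)) \<le> X" by simp linarith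
      qed
      finally show ?thesis .
    qed
    \<comment> \<open>the one extra integer in an interval is harmless because \<open>X powr p \<ge> 1\<close>\<close>
    have count: "real (card {\<lceil>X powr p\<rceil>..\<lfloor>(2 * X) powr p\<rfloor>}) \<le> 2 * X powr p"
    proof -
      have "(2 * X) powr p = 2 powr p * X powr p" using X by (simp add: powr_mult)
      also have "\<dots> \<le> 2 powr 1 * X powr p"
        using p by (intro mult_right_mono powr_mono) auto
      finally have "(2 * X) powr p \<le> 2 * X powr p" by simp
      moreover have "X powr p \<ge> 1" using X p by (simp add: ge_one_powr_ge_zero)
      ultimately show ?thesis by (simp add: of_nat_nat) linarith
    qed
    have "norm (\<Sum>n=\<lceil>X\<rceil>..\<lfloor>2 * X\<rfloor>. \<Sum>m=\<lceil>X powr p\<rceil>..\<lfloor>(2 * X) powr p\<rfloor>. A (n + m ^ k)) =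
          norm (\<Sum>m=\<lceil>X powr p\<rceil>..\<lfloor>(2 * X) powr p\<rfloor>. \<Sum>n=\<lceil>X\<rceil>..\<lfloor>2 * X\<rfloor>. A (n + m ^ k))"
      by (subst sum.swap) (rule refl)
    also have "\<dots> \<le> (\<Sum>m=\<lceil>X powr p\<rceil>..\<lfloor>(2 * X) powr p\<rfloor>. K * sqrt X * ln (2 + X))"
      by (intro sum_norm_le inner)
    also have "\<dots> = real (card {\<lceil>X powr p\<rceil>..\<lfloor>(2 * X) powr p\<rfloor>}) * (K * sqrt X * ln (2 + X))"
      by (rule sum_constant)
    also have "\<dots> \<le> (2 * X powr p) * (K * sqrt X * (12 * X powr (1/4)))"
      using X K(1) by (intro mult_mono count ln_le_powr_quarter order.refl)
        (auto intro!: mult_nonneg_nonneg ln_ge_zero)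
    also have "\<dots> = 24 * K * (X powr p * X powr (1/2) * X powr (1/4))"
      using X powr_half_sqrt[of X] by (simp del: powr_half_sqrt)
    also have "\<dots> = 24 * K * X powr (p + 1/2 + 1/4)"
      by (simp only: powr_add)
    also have "\<dots> \<le> 24 * K * X powr (1 + p - (1 / (4 * real k) + 1 / 2 ^ (l + 4)) + \<epsilon>)"
      using X K(1) saving \<epsilon> by (intro mult_left_mono powr_mono) auto
    finally show "norm (\<Sum>n = \<lceil>X\<rceil>..\<lfloor>2 * X\<rfloor>.
        \<Sum>m = \<lceil>X powr (1 / real k)\<rceil>..\<lfloor>(2 * X) powr (1 / real k)\<rfloor>. A (n + m ^ k))
      \<le> 24 * K * X powr (1 + 1 / real k - (1 / (4 * real k) + 1 / 2 ^ (l + 4)) + \<epsilon>)"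
      unfolding p_def .
  qed
qed

end
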